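(* Let $T_1,\dots,T_r$ be new indeterminates. Let $F:C[T_1,\dots,T_r]\to C_{\sigma_q}$ be the homomorphism of $C$-algebras with $F(T_i)=f_i/\tau_i$ for $1\le i\le r$, and let $G$ be the automorphism of the $A'[\underline{X}_1,\dots,\underline{X}_s,T_1,\dots,T_r]$-algebra $C[T_1,\dots,T_r]$ with $G(\varepsilon_i)=\varepsilon_i-T_i$ for $1\le i\le r$. Then $\ker F$ coincides with the image under $G$ of the ideal $\mathcal{T}[T_1,\dots,T_r]$ of $C[T_1,\dots,T_r]$: $$\ker F=G(\mathcal{T}[T_1,\dots,T_r]).$$
   Context: Let $K$ be a commutative integral domain, $s\ge 1$, and $n_s\ge\dots\ge n_1\ge 1$ integers. For $1\le j\le s$ let $\underline{X}_j=(X_{j,1},\dots,X_{j,n_j+1})$ be a packet of indeterminates; for $\underline{\alpha}_j\in\mathbb{N}^{n_j+1}$ let $|\underline{\alpha}_j|$ be the sum of its entries and $\underline{X}_j^{\underline{\alpha}_j}$ the corresponding monomial. Let $r\in\mathbb{N}$ and $d_{i,j}\ge 1$ ($1\le i\le r$, $1\le j\le s$) be integers. Let $A=K[U_{i,\underline{\alpha}_1,\dots,\underline{\alpha}_s}]$ be the polynomial ring in indeterminates indexed by $1\le i\le r$ and $\underline{\alpha}_j\in\mathbb{N}^{n_j+1}$ with $|\underline{\alpha}_j|=d_{i,j}$ for all $j$. Let $C=A[\underline{X}_1,\dots,\underline{X}_s]$, $f_i=\sum U_{i,\underline{\alpha}_1,\dots,\underline{\alpha}_s}\underline{X}_1^{\underline{\alpha}_1}\cdots\underline{X}_s^{\underline{\alpha}_s}\in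 C$ (sum over all $(\underline{\alpha}_j)_j$ with $|\underline{\alpha}_j|=d_{i,j}$), and $B=C/(f_1,\dots,f_r)$. For $1\le i_j\le n_j+1$ put $\sigma_{i_1\dots i_s}=X_{1,i_1}\cdots X_{s,i_s}$, and $\sigma_q=X_{1,n_1+1}\cdots X_{s,n_s+1}$. Let $p:C\to B$ be the canonical surjection and $\pi:B\to\prod_{i_1,\dots,i_s}B_{\sigma_{i_1\dots i_s}}$, $b\mapsto(b/1,\dots,b/1)$. The ideal of forms of inertia is $\mathcal{T}=p^{-1}(\ker\pi)$. Let $\tau_i=X_{1,n_1+1}^{d_{i,1}}\cdots X_{s,n_s+1}^{d_{i,s}}$ and let $\varepsilon_i$ be the coefficient (one of the indeterminates $U$) of $\tau_i$ in $f_i$. Let $A'$ be the polynomial ring over $K$ in all the indeterminates $U_{i,\underline{\alpha}_1,\dots,\underline{\alpha}_s}$ other than $\varepsilon_1,\dots,\varepsilon_r$, so $A=A'[\varepsilon_1,\dots,\varepsilon_r]$. $\mathcal{T}[T_1,\dots,T_r]$ denotes the set of polynomials in $T_1,\dots,T_r$ with coefficients in $\mathcal{T}$. *)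

theory Defs
  imports "HOL-Algebra.QuotRing" "HOL-Library.Poly_Mapping"
begin

section \<open>Commutative algebra\<close>

text \<open>A subset of a commutative ring type as a ring with explicit carrier (meant for subrings).\<close>

definition ring_on :: "'a::comm_ring_1 set \<Rightarrow> 'a ring" where
  "ring_on S = \<lparr>carrier = S, mult = (*), one = 1, zero = 0, add = (+)\<rparr>"

text \<open>Localization: classes of pairs (numerator, denominator) with denominator in \<open>S\<close>.
  The ring \<open>R\<close> may have zero divisors, hence the factor \<open>u\<close>.\<close>

definition loc_rel :: "('a, 'm) ring_scheme \<Rightarrow> 'a set \<Rightarrow> (('a \<times> 'a) \<times> ('a \<times> 'a)) set" where
  "loc_rel R S = {((a, s), (b, t)). a \<in> carrier R \<and> s \<in> S \<and> b \<in> carrier R \<and> t \<in> S \<and>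
     (\<exists>u\<in>S. u \<otimes>\<^bsub>R\<^esub> (a \<otimes>\<^bsub>R\<^esub> t \<ominus>\<^bsub>R\<^esub> b \<otimes>\<^bsub>R\<^esub> s) = \<zero>\<^bsub>R\<^esub>)}"

definition loc_frac :: "('a, 'm) ring_scheme \<Rightarrow> 'a set \<Rightarrow> 'a \<Rightarrow> 'a \<Rightarrow> ('a \<times> 'a) set" where
  "loc_frac R S a s = loc_rel R S `` {(a, s)}"

definition localization :: "('a, 'm) ring_scheme \<Rightarrow> 'a set \<Rightarrow> ('a \<times> 'a) set ring" where
  "localization R S =
    \<lparr>carrier = (carrier R \<times> S) // loc_rel R S,
     mult = (\<lambda>X Y. \<Union>(a, s)\<in>X. \<Union>(b, t)\<in>Y. loc_frac R S (a \<otimes>\<^bsub>R\<^esub> b) (s \<otimes>\<^bsub>R\<^esub> t)),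
     one = loc_frac R S \<one>\<^bsub>R\<^esub> \<one>\<^bsub>R\<^esub>,
     zero = loc_frac R S \<zero>\<^bsub>R\<^esub> \<one>\<^bsub>R\<^esub>,
     add = (\<lambda>X Y. \<Union>(a, s)\<in>X. \<Union>(b, t)\<in>Y.
              loc_frac R S (a \<otimes>\<^bsub>R\<^esub> t \<oplus>\<^bsub>R\<^esub> b \<otimes>\<^bsub>R\<^esub> s) (s \<otimes>\<^bsub>R\<^esub> t))\<rparr>"

definition powers :: "('a, 'm) ring_scheme \<Rightarrow> 'a \<Rightarrow> 'a set" where
  "powers R x = {x [^]\<^bsub>R\<^esub> k | k :: nat. True}"

definition localization_at :: "('a, 'm) ring_scheme \<Rightarrow> 'a \<Rightarrow> ('a \<times> 'a) set ring" where
  "localization_at R x = localization R (powers R x)"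

definition to_localization_at :: "('a, 'm) ring_scheme \<Rightarrow> 'a \<Rightarrow> 'a \<Rightarrow> ('a \<times> 'a) set" where
  "to_localization_at R x a = loc_frac R (powers R x) a \<one>\<^bsub>R\<^esub>"

definition product_ring :: "'i set \<Rightarrow> ('i \<Rightarrow> ('a, 'm) ring_scheme) \<Rightarrow> ('i \<Rightarrow> 'a) ring" where
  "product_ring I R =
    \<lparr>carrier = (\<Pi>\<^sub>E i\<in>I. carrier (R i)),
     mult = (\<lambda>x y. \<lambda>i\<in>I. x i \<otimes>\<^bsub>R i\<^esub> y i),
     one = (\<lambda>i\<in>I. \<one>\<^bsub>R i\<^esub>),
     zero = (\<lambda>i\<in>I. \<zero>\<^bsub>R i\<^esub>),
     add = (\<lambda>x y. \<lambda>i\<in>I. x i \<oplus>\<^bsub>R i\<^esub> y i)\<rparr>"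

section \<open>Polynomials\<close>

text \<open>Polynomials with coefficients in \<open>'a\<close> and indeterminates indexed by \<open>'v\<close>:
  finitely supported functions on the monomials, with the convolution product.\<close>

type_synonym ('v, 'a) mpoly = "('v \<Rightarrow>\<^sub>0 nat) \<Rightarrow>\<^sub>0 'a"

text \<open>Polynomials with coefficients in \<open>S\<close> in the indeterminates indexed by \<open>V\<close>, that is
  \<open>S[V]\<close> for a subring or an ideal \<open>S\<close>.\<close>

definition polys :: "'a::comm_ring_1 set \<Rightarrow> 'v set \<Rightarrow> ('v, 'a) mpoly set" where
  "polys S V = {p. (\<forall>m. Poly_Mapping.lookup p m \<in> S) \<and>
     (\<forall>m\<in>Poly_Mapping.keys p. Poly_Mapping.keys m \<subseteq> V)}"

definition pmonom :: "('v \<Rightarrow>\<^sub>0 nat) \<Rightarrow> ('v, 'a::comm_ring_1) mpoly" where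
  "pmonom m = Poly_Mapping.single m 1"

definition pvar :: "'v \<Rightarrow> ('v, 'a::comm_ring_1) mpoly" where
  "pvar v = pmonom (Poly_Mapping.single v 1)"

definition pconst :: "'a::comm_ring_1 \<Rightarrow> ('v, 'a) mpoly" where
  "pconst c = Poly_Mapping.single 0 c"

section \<open>Generic multihomogeneous polynomials\<close>

text \<open>\<open>X\<^bsub>j,k\<^esub>\<close> is indexed by \<open>(j, k)\<close>. A family of multi-exponents
  \<open>(\<alpha>\<^sub>1, \<dots>, \<alpha>\<^sub>s)\<close> is encoded as a single multi-exponent \<open>\<alpha>\<close> on
  these indices, \<open>lookup \<alpha> (j, k)\<close> being the \<open>k\<close>-th entry of \<open>\<alpha>\<^sub>j\<close>.\<close>

type_synonym mexp = "nat \<times> nat \<Rightarrow>\<^sub>0 nat"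
type_synonym 'k A_poly = "(nat \<times> mexp, 'k) mpoly"
type_synonym 'k C_poly = "(nat \<times> nat, 'k A_poly) mpoly"
type_synonym 'k CT_poly = "(nat, 'k C_poly) mpoly"

text \<open>Parameters throughout: \<open>s\<close> the number of packets, \<open>n j + 1\<close> the size of the \<open>j\<close>-th
  packet, \<open>r\<close> the number of polynomials, \<open>d i j\<close> the degree of \<open>f\<^sub>i\<close> in the \<open>j\<close>-th packet.
  The ring \<open>K\<close> is the type \<open>'k\<close>.\<close>

definition X_idx :: "nat \<Rightarrow> (nat \<Rightarrow> nat) \<Rightarrow> (nat \<times> nat) set" where
  "X_idx s n = (SIGMA j:{1..s}. {1..n j + 1})"

definition mexps :: "nat \<Rightarrow> (nat \<Rightarrow> nat) \<Rightarrow> (nat \<Rightarrow> nat) \<Rightarrow> mexp set" where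
  "mexps s n e = {\<alpha>. Poly_Mapping.keys \<alpha> \<subseteq> X_idx s n \<and>
     (\<forall>j\<in>{1..s}. (\<Sum>k=1..n j + 1. Poly_Mapping.lookup \<alpha> (j, k)) = e j)}"

definition U_idx :: "nat \<Rightarrow> (nat \<Rightarrow> nat) \<Rightarrow> nat \<Rightarrow> (nat \<Rightarrow> nat \<Rightarrow> nat) \<Rightarrow> (nat \<times> mexp) set" where
  "U_idx s n r d = (SIGMA i:{1..r}. mexps s n (d i))"

definition A_set :: "nat \<Rightarrow> (nat \<Rightarrow> nat) \<Rightarrow> nat \<Rightarrow> (nat \<Rightarrow> nat \<Rightarrow> nat) \<Rightarrow> 'k::idom A_poly set" where
  "A_set s n r d = polys UNIV (U_idx s n r d)"

definition C_set :: "nat \<Rightarrow> (nat \<Rightarrow> nat) \<Rightarrow> nat \<Rightarrow> (nat \<Rightarrow> nat \<Rightarrow> nat) \<Rightarrow> 'k::idom C_poly set" where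
  "C_set s n r d = polys (A_set s n r d) (X_idx s n)"

definition C_ring :: "nat \<Rightarrow> (nat \<Rightarrow> nat) \<Rightarrow> nat \<Rightarrow> (nat \<Rightarrow> nat \<Rightarrow> nat) \<Rightarrow> 'k::idom C_poly ring" where
  "C_ring s n r d = ring_on (C_set s n r d)"

definition CT_ring :: "nat \<Rightarrow> (nat \<Rightarrow> nat) \<Rightarrow> nat \<Rightarrow> (nat \<Rightarrow> nat \<Rightarrow> nat) \<Rightarrow> 'k::idom CT_poly ring" where
  "CT_ring s n r d = ring_on (polys (C_set s n r d) {1..r})"

definition f_poly :: "nat \<Rightarrow> (nat \<Rightarrow> nat) \<Rightarrow> (nat \<Rightarrow> nat \<Rightarrow> nat) \<Rightarrow> nat \<Rightarrow> 'k::idom C_poly" where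
  "f_poly s n d i = (\<Sum>\<alpha>\<in>mexps s n (d i). pconst (pvar (i, \<alpha>)) * pmonom \<alpha>)"

definition f_ideal ::
    "nat \<Rightarrow> (nat \<Rightarrow> nat) \<Rightarrow> nat \<Rightarrow> (nat \<Rightarrow> nat \<Rightarrow> nat) \<Rightarrow> 'k::idom C_poly set" where
  "f_ideal s n r d = genideal (C_ring s n r d) (f_poly s n d ` {1..r})"

definition B_ring ::
    "nat \<Rightarrow> (nat \<Rightarrow> nat) \<Rightarrow> nat \<Rightarrow> (nat \<Rightarrow> nat \<Rightarrow> nat) \<Rightarrow> 'k::idom C_poly set ring" where
  "B_ring s n r d = C_ring s n r d Quot f_ideal s n r d"

definition p_map :: "nat \<Rightarrow> (nat \<Rightarrow> nat) \<Rightarrow> nat \<Rightarrow> (nat \<Rightarrow> nat \<Rightarrow> nat) \<Rightarrow>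
    'k::idom C_poly \<Rightarrow> 'k C_poly set" where
  "p_map s n r d c = f_ideal s n r d +>\<^bsub>C_ring s n r d\<^esub> c"

text \<open>\<open>\<iota>\<close> is the tuple \<open>(i\<^sub>1, \<dots>, i\<^sub>s)\<close>.\<close>

definition sigma_idx :: "nat \<Rightarrow> (nat \<Rightarrow> nat) \<Rightarrow> (nat \<Rightarrow> nat) set" where
  "sigma_idx s n = (\<Pi>\<^sub>E j\<in>{1..s}. {1..n j + 1})"

definition sigma_poly :: "nat \<Rightarrow> (nat \<Rightarrow> nat) \<Rightarrow> 'k::idom C_poly" where
  "sigma_poly s \<iota> = (\<Prod>j=1..s. pvar (j, \<iota> j))"

definition sigma_q :: "nat \<Rightarrow> (nat \<Rightarrow> nat) \<Rightarrow> 'k::idom C_poly" where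
  "sigma_q s n = (\<Prod>j=1..s. pvar (j, n j + 1))"

definition B_sigma :: "nat \<Rightarrow> (nat \<Rightarrow> nat) \<Rightarrow> nat \<Rightarrow> (nat \<Rightarrow> nat \<Rightarrow> nat) \<Rightarrow> (nat \<Rightarrow> nat) \<Rightarrow>
    ('k::idom C_poly set \<times> 'k C_poly set) set ring" where
  "B_sigma s n r d \<iota> = localization_at (B_ring s n r d) (p_map s n r d (sigma_poly s \<iota>))"

definition pi_map :: "nat \<Rightarrow> (nat \<Rightarrow> nat) \<Rightarrow> nat \<Rightarrow> (nat \<Rightarrow> nat \<Rightarrow> nat) \<Rightarrow>
    'k::idom C_poly set \<Rightarrow> (nat \<Rightarrow> nat) \<Rightarrow> ('k C_poly set \<times> 'k C_poly set) set" where
  "pi_map s n r d b = (\<lambda>\<iota>\<in>sigma_idx s n.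
     to_localization_at (B_ring s n r d) (p_map s n r d (sigma_poly s \<iota>)) b)"

definition inertia_forms ::
    "nat \<Rightarrow> (nat \<Rightarrow> nat) \<Rightarrow> nat \<Rightarrow> (nat \<Rightarrow> nat \<Rightarrow> nat) \<Rightarrow> 'k::idom C_poly set" where
  "inertia_forms s n r d = {c \<in> carrier (C_ring s n r d).
     p_map s n r d c \<in> a_kernel (B_ring s n r d)
       (product_ring (sigma_idx s n) (B_sigma s n r d)) (pi_map s n r d)}"

definition tau_poly :: "nat \<Rightarrow> (nat \<Rightarrow> nat) \<Rightarrow> (nat \<Rightarrow> nat \<Rightarrow> nat) \<Rightarrow> nat \<Rightarrow> 'k::idom C_poly" where
  "tau_poly s n d i = (\<Prod>j=1..s. pvar (j, n j + 1) ^ d i j)"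

definition tau_exp :: "nat \<Rightarrow> (nat \<Rightarrow> nat) \<Rightarrow> (nat \<Rightarrow> nat \<Rightarrow> nat) \<Rightarrow> nat \<Rightarrow> mexp" where
  "tau_exp s n d i = (\<Sum>j=1..s. Poly_Mapping.single (j, n j + 1) (d i j))"

definition eps_poly :: "nat \<Rightarrow> (nat \<Rightarrow> nat) \<Rightarrow> (nat \<Rightarrow> nat \<Rightarrow> nat) \<Rightarrow> nat \<Rightarrow> 'k::idom A_poly" where
  "eps_poly s n d i = pvar (i, tau_exp s n d i)"

definition A'_set ::
    "nat \<Rightarrow> (nat \<Rightarrow> nat) \<Rightarrow> nat \<Rightarrow> (nat \<Rightarrow> nat \<Rightarrow> nat) \<Rightarrow> 'k::idom A_poly set" where
  "A'_set s n r d = polys UNIV (U_idx s n r d - (\<lambda>i. (i, tau_exp s n d i)) ` {1..r})"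

definition A'XT_set ::
    "nat \<Rightarrow> (nat \<Rightarrow> nat) \<Rightarrow> nat \<Rightarrow> (nat \<Rightarrow> nat \<Rightarrow> nat) \<Rightarrow> 'k::idom CT_poly set" where
  "A'XT_set s n r d = polys (polys (A'_set s n r d) (X_idx s n)) {1..r}"

text \<open>Since \<open>\<tau>\<^sub>i\<close> divides a power of \<open>\<sigma>\<^sub>q\<close> but need not be one, the fraction
  \<open>f\<^sub>i / \<tau>\<^sub>i\<close> is formed with the inverse of \<open>\<tau>\<^sub>i / 1\<close> in the localization.\<close>

definition f_over_tau :: "nat \<Rightarrow> (nat \<Rightarrow> nat) \<Rightarrow> nat \<Rightarrow> (nat \<Rightarrow> nat \<Rightarrow> nat) \<Rightarrow> nat \<Rightarrow>
    ('k::idom C_poly \<times> 'k C_poly) set" where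
  "f_over_tau s n r d i =
    (let C = C_ring s n r d; L = localization_at C (sigma_q s n)
     in to_localization_at C (sigma_q s n) (f_poly s n d i) \<otimes>\<^bsub>L\<^esub>
        inv\<^bsub>L\<^esub> (to_localization_at C (sigma_q s n) (tau_poly s n d i)))"

section \<open>The indeterminate \<open>\<epsilon>\<^sub>i\<close> is the coefficient of \<open>\<tau>\<^sub>i\<close> in \<open>f\<^sub>i\<close>\<close>

lemma finite_mexps: "finite (mexps s n e)"
proof -
  define M where "M = (\<Sum>j\<in>{1..s}. e j)"
  have "Poly_Mapping.lookup \<alpha> ` X_idx s n \<subseteq> {..M}" if "\<alpha> \<in> mexps s n e" for \<alpha>
  proof (clarsimp simp: X_idx_def)
    fix j k assume jk: "Suc 0 \<le> j" "j \<le> s" "Suc 0 \<le> k" "k \<le> Suc (n j)"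
    have "Poly_Mapping.lookup \<alpha> (j, k) \<le> (\<Sum>k=1..n j + 1. Poly_Mapping.lookup \<alpha> (j, k))"
      using jk by (intro member_le_sum) auto
    also have "\<dots> = e j" using that jk by (auto simp: mexps_def)
    also have "\<dots> \<le> M" unfolding M_def using jk by (intro member_le_sum) auto
    finally show "Poly_Mapping.lookup \<alpha> (j, k) \<le> M" .
  qed
  then have "(\<lambda>\<alpha>. restrict (Poly_Mapping.lookup \<alpha>) (X_idx s n)) ` mexps s n e \<subseteq> (\<Pi>\<^sub>E v\<in>X_idx s n. {..M})"
    by fastforce
  moreover have "finite (\<Pi>\<^sub>E v\<in>X_idx s n. {..M})"
    by (intro finite_PiE) (auto simp: X_idx_def)
  ultimately have "finite ((\<lambda>\<alpha>. restrict (Poly_Mapping.lookup \<alpha>) (X_idx s n)) ` mexps s n e)"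
    by (rule finite_subset)
  moreover have "inj_on (\<lambda>\<alpha>. restrict (Poly_Mapping.lookup \<alpha>) (X_idx s n)) (mexps s n e)"
  proof (rule inj_onI, rule poly_mapping_eqI)
    fix \<alpha> \<beta> v
    assume "\<alpha> \<in> mexps s n e" "\<beta> \<in> mexps s n e"
      and eq: "restrict (Poly_Mapping.lookup \<alpha>) (X_idx s n) = restrict (Poly_Mapping.lookup \<beta>) (X_idx s n)"
    then have "Poly_Mapping.keys \<alpha> \<subseteq> X_idx s n" "Poly_Mapping.keys \<beta> \<subseteq> X_idx s n" by (auto simp: mexps_def)
    then show "Poly_Mapping.lookup \<alpha> v = Poly_Mapping.lookup \<beta> v"
      using fun_cong[OF eq, of v] in_keys_iff[of v \<alpha>] in_keys_iff[of v \<beta>]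
      by (cases "v \<in> X_idx s n") auto
  qed
  ultimately show ?thesis by (rule finite_imageD)
qed

lemma lookup_tau_exp:
  "Poly_Mapping.lookup (tau_exp s n d i) (j, k) = (if j \<in> {1..s} \<and> k = n j + 1 then d i j else 0)"
proof -
  have "Poly_Mapping.lookup (tau_exp s n d i) (j, k) =
      (\<Sum>j'=1..s. if j' = j then (if k = n j + 1 then d i j else 0) else 0)"
    unfolding tau_exp_def lookup_sum
    by (intro sum.cong) (auto simp: lookup_single when_def)
  also have "\<dots> = (if j \<in> {1..s} \<and> k = n j + 1 then d i j else 0)"
    by (subst sum.delta) auto
  finally show ?thesis .
qed

lemma tau_exp_in_mexps: "tau_exp s n d i \<in> mexps s n (d i)"
  by (auto simp: mexps_def X_idx_def in_keys_iff lookup_tau_exp split: if_splits)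

lemma pvar_power: "pvar v ^ e = pmonom (Poly_Mapping.single v e)"
  by (induction e) (auto simp: pvar_def pmonom_def mult_single single_add[symmetric])

lemma tau_poly_eq_pmonom: "tau_poly s n d i = pmonom (tau_exp s n d i)"
proof -
  have "(\<Prod>j\<in>J. pmonom (g j)) = pmonom (\<Sum>j\<in>J. g j)" for g :: "nat \<Rightarrow> mexp" and J
    by (induction J rule: infinite_finite_induct) (auto simp: pmonom_def mult_single)
  then show ?thesis by (simp add: tau_poly_def tau_exp_def pvar_power)
qed

lemma eps_poly_eq_coeff:
  "eps_poly s n d i = Poly_Mapping.lookup (f_poly s n d i :: 'k::idom C_poly) (tau_exp s n d i)"
proof -
  have "Poly_Mapping.lookup (f_poly s n d i :: 'k C_poly) (tau_exp s n d i) =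
      (\<Sum>\<alpha>\<in>mexps s n (d i). if \<alpha> = tau_exp s n d i then pvar (i, \<alpha>) else 0)"
    unfolding f_poly_def lookup_sum
    by (intro sum.cong)
       (auto simp: pconst_def pmonom_def mult_single lookup_single when_def)
  then show ?thesis
    by (simp add: eps_poly_def sum.delta finite_mexps tau_exp_in_mexps)
qed

end

theory Submission
  imports Defs "HOL-Library.Product_Lexorder" "HOL-Computational_Algebra.Polynomial_Factorial"
begin

text \<open>
  Write \<open>f\<^sub>i = \<epsilon>\<^sub>i \<tau>\<^sub>i + g\<^sub>i\<close>, where \<open>g\<^sub>i\<close> lies in \<open>A'[X]\<close>.  As \<open>G\<close> fixes everything but the \<open>\<epsilon>\<^sub>i\<close>, one has
  \<open>G f\<^sub>i = f\<^sub>i - T\<^sub>i \<tau>\<^sub>i\<close>, which \<open>F\<close> sends to \<open>0\<close>.  So \<open>F \<circ> G\<close> kills the ideal \<open>(f) = (f\<^sub>1, \<dots>, f\<^sub>r)\<close> of \<open>C\<close>.  It fixes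
  \<open>\<sigma>\<^sub>q\<close>, which is invertible in the target, so it also kills every \<open>c\<close> with \<open>\<sigma>\<^sub>q\<^sup>N c \<in> (f)\<close>.  Inertia forms have
  this property, which proves that \<open>G (\<T>[T])\<close> is contained in the kernel of \<open>F\<close> (\<open>FG_eq_0_if_inertia\<close>).

  For the other inclusion, let \<open>F (G P) = 0\<close>.  Since \<open>\<tau>\<^sub>i \<epsilon>\<^sub>i \<equiv> - g\<^sub>i\<close> modulo \<open>(f)\<close> and \<open>\<tau>\<^sub>i\<close> divides a power of \<open>\<sigma>\<^sub>q\<close>,
  a suitable \<open>\<sigma>\<^sub>q\<^sup>N P\<close> is congruent to some \<open>Q\<close> in \<open>A'[X][T]\<close> (\<open>pseudo_division_CT\<close>).  As \<open>G Q = Q\<close>, this gives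
  \<open>F Q = 0\<close>.  But \<open>F\<close> is injective on \<open>A'[X][T]\<close>, because the \<open>f\<^sub>i / \<tau>\<^sub>i = \<epsilon>\<^sub>i + g\<^sub>i / \<tau>\<^sub>i\<close> are algebraically
  independent over \<open>A'[X]\<close> (\<open>eps_free_CT_kernel_trivial\<close>); so \<open>Q = 0\<close>, and \<open>\<sigma>\<^sub>q\<^sup>N\<close> brings every coefficient of \<open>P\<close>
  into \<open>(f)\<close>.

  It remains to see that such coefficients are inertia forms, that is, that saturating \<open>(f)\<close> with
  respect to \<open>\<sigma>\<^sub>q\<close> or to any other \<open>\<sigma>\<^bsub>i\<^sub>1\<dots>i\<^sub>s\<^esub>\<close> gives the same ideal (\<open>saturation_independent\<close>).  The same
  elimination works with any choice of one indeterminate in each packet, a ``chart'', since every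
  \<open>f\<^sub>i\<close> is generic.  In each chart an element of \<open>A'[X]\<close> is zero if its product
  with some nonzero element of \<open>A'[X]\<close> lies in \<open>(f)\<close>
  (\<open>eps_free_eq_0_if_mult_in_f_ideal\<close>), by the substitution \<open>\<epsilon>\<^sub>i \<mapsto> - g\<^sub>i / \<tau>\<^sub>i\<close>.

  The arguments take place in polynomial types over \<open>K\<close> and their fraction fields.  These types are
  integral domains once their indices are linearly ordered, which is what the lexicographic order on
  pairs provides.
\<close>

section \<open>Polynomial rings\<close>

text \<open>The rings \<open>A\<close>, \<open>C\<close>, \<open>C[T]\<close> and their subrings without the \<open>\<epsilon>\<^sub>i\<close> are subsets of
  polynomial types.  Closure under subtraction gives \<open>0\<close>, negatives and sums.\<close>

definition is_subring :: "'a::comm_ring_1 set \<Rightarrow> bool" where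
  "is_subring S \<longleftrightarrow> 1 \<in> S \<and> (\<forall>x\<in>S. \<forall>y\<in>S. x - y \<in> S \<and> x * y \<in> S)"

lemma is_subringD:
  assumes "is_subring S"
  shows "1 \<in> S" "0 \<in> S" "x \<in> S \<Longrightarrow> y \<in> S \<Longrightarrow> x - y \<in> S" "x \<in> S \<Longrightarrow> y \<in> S \<Longrightarrow> x * y \<in> S"
    "x \<in> S \<Longrightarrow> - x \<in> S" "x \<in> S \<Longrightarrow> y \<in> S \<Longrightarrow> x + y \<in> S"
proof -
  show one: "1 \<in> S" using assms by (simp add: is_subring_def)
  show diff: "x \<in> S \<Longrightarrow> y \<in> S \<Longrightarrow> x - y \<in> S" for x y
    using assms by (simp add: is_subring_def)
  show mult: "x \<in> S \<Longrightarrow> y \<in> S \<Longrightarrow> x * y \<in> S" for x y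
    using assms by (simp add: is_subring_def)
  show zero: "0 \<in> S" using diff[OF one one] by simp
  show um: "x \<in> S \<Longrightarrow> - x \<in> S" for x using diff[OF zero, of x] by simp
  show "x \<in> S \<Longrightarrow> y \<in> S \<Longrightarrow> x + y \<in> S" for x y
    using diff[of x "- y"] um[of y] by simp
qed

lemma is_subring_UNIV [simp]: "is_subring UNIV"
  by (simp add: is_subring_def)

lemma is_subring_sum: "is_subring S \<Longrightarrow> (\<And>i. i \<in> I \<Longrightarrow> f i \<in> S) \<Longrightarrow> sum f I \<in> S"
  by (induction I rule: infinite_finite_induct) (auto intro: is_subringD)

lemma pconst_mult_pmonom: "pconst c * pmonom m = Poly_Mapping.single m c"
  by (simp add: pconst_def pmonom_def mult_single)

lemma pconst_add: "pconst (a + b) = pconst a + pconst b"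
  by (simp add: pconst_def single_add)

lemma pconst_diff: "pconst (a - b) = pconst a - pconst b"
  by (simp add: pconst_def single_diff)

lemma pconst_mult: "pconst (a * b) = pconst a * pconst b"
  by (simp add: pconst_def mult_single)

lemma pconst_0 [simp]: "pconst 0 = 0"
  by (simp add: pconst_def)

lemma pconst_1 [simp]: "pconst 1 = 1"
  by (simp add: pconst_def)

lemma pmonom_0 [simp]: "pmonom 0 = 1"
  by (simp add: pmonom_def)

lemma pmonom_add: "pmonom (m + n) = pmonom m * pmonom n"
  by (simp add: pmonom_def mult_single)

lemma pmonom_sum: "pmonom (\<Sum>i\<in>I. m i) = (\<Prod>i\<in>I. pmonom (m i))"
  by (induction I rule: infinite_finite_induct) (auto simp: pmonom_add)

lemma pmonom_eq_prod_pvar: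
  "pmonom m = (\<Prod>v\<in>Poly_Mapping.keys m. pvar v ^ Poly_Mapping.lookup m v)"
proof -
  have "m = (\<Sum>v\<in>Poly_Mapping.keys m. Poly_Mapping.single v (Poly_Mapping.lookup m v))"
    by (rule poly_mapping_eqI) (auto simp: lookup_sum lookup_single when_def sum.delta in_keys_iff)
  then have "pmonom m = pmonom (\<Sum>v\<in>Poly_Mapping.keys m. Poly_Mapping.single v (Poly_Mapping.lookup m v))"
    by simp
  then show ?thesis by (simp add: pmonom_sum pvar_power)
qed

lemma pmonom_neq_0 [simp]: "pmonom m \<noteq> 0"
  unfolding pmonom_def by (metis lookup_single_eq lookup_zero zero_neq_one)

lemma pconst_eq_0_iff [simp]: "pconst c = 0 \<longleftrightarrow> c = 0"
  unfolding pconst_def by (metis lookup_single_eq lookup_zero single_zero)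

lemma poly_eq_sum_monomials:
  "p = (\<Sum>m\<in>Poly_Mapping.keys p. pconst (Poly_Mapping.lookup p m) * pmonom m)"
  by (rule poly_mapping_eqI)
     (auto simp: pconst_mult_pmonom lookup_sum lookup_single when_def sum.delta in_keys_iff)

lemma lookup_pconst_mult: "Poly_Mapping.lookup (pconst a * p) m = a * Poly_Mapping.lookup p m"
  unfolding pconst_def mult_map_scale_conv_mult[symmetric]
  by (simp add: Poly_Mapping.map.rep_eq when_def)

lemma polys_lookup: "p \<in> polys S V \<Longrightarrow> Poly_Mapping.lookup p m \<in> S"
  by (simp add: polys_def)

lemma polys_monomial:
  "c \<in> S \<Longrightarrow> 0 \<in> S \<Longrightarrow> Poly_Mapping.keys m \<subseteq> V \<Longrightarrow> pconst c * pmonom m \<in> polys S V"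
  by (auto simp: polys_def pconst_mult_pmonom lookup_single when_def split: if_splits)

lemma polys_pconst: "c \<in> S \<Longrightarrow> 0 \<in> S \<Longrightarrow> pconst c \<in> polys S V"
  using polys_monomial[of c S 0 V] by simp

lemma polys_pmonom: "1 \<in> S \<Longrightarrow> 0 \<in> S \<Longrightarrow> Poly_Mapping.keys m \<subseteq> V \<Longrightarrow> pmonom m \<in> polys S V"
  using polys_monomial[of 1 S m V] by simp

lemma polys_pvar: "is_subring S \<Longrightarrow> v \<in> V \<Longrightarrow> pvar v \<in> polys S V"
  unfolding pvar_def by (rule polys_pmonom) (auto dest: is_subringD)

lemma polys_add:
  assumes "\<And>x y. x \<in> S \<Longrightarrow> y \<in> S \<Longrightarrow> x + y \<in> S" "p \<in> polys S V" "q \<in> polys S V"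
  shows "p + q \<in> polys S V"
  using assms keys_add[of p q] by (fastforce simp: polys_def lookup_add)

lemma polys_pconst_mult:
  assumes "p \<in> polys S V" "\<And>x. x \<in> S \<Longrightarrow> a * x \<in> T"
  shows "pconst a * p \<in> polys T V"
proof -
  have "Poly_Mapping.keys (pconst a * p) \<subseteq> Poly_Mapping.keys p"
    by (auto simp: in_keys_iff lookup_pconst_mult)
  with assms show ?thesis by (auto simp: polys_def lookup_pconst_mult)
qed

lemma polys_mono: "S \<subseteq> S' \<Longrightarrow> V \<subseteq> V' \<Longrightarrow> polys S V \<subseteq> polys S' V'"
  by (force simp: polys_def)

text \<open>Additive induction: it suits properties of single coefficients and, unlike the multiplicative
  induction below, also covers polynomials with coefficients in an ideal.\<close>

lemma polys_sum_induct [consumes 1, case_names zero monomial add]: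
  assumes p: "p \<in> polys S V" and z: "Q 0"
    and mon: "\<And>c m. c \<in> S \<Longrightarrow> Poly_Mapping.keys m \<subseteq> V \<Longrightarrow> Q (pconst c * pmonom m)"
    and add: "\<And>x y. Q x \<Longrightarrow> Q y \<Longrightarrow> Q (x + y)"
  shows "Q p"
proof -
  have sum: "Q (sum f I)" if "\<And>i. i \<in> I \<Longrightarrow> Q (f i)" for f and I :: "('a \<Rightarrow>\<^sub>0 nat) set"
    using that by (induction I rule: infinite_finite_induct) (auto intro: z add)
  show ?thesis
    by (subst poly_eq_sum_monomials, rule sum, rule mon) (use p in \<open>auto simp: polys_def\<close>)
qed

lemma polys_mult:
  assumes S: "is_subring S" and p: "p \<in> polys S V" and q: "q \<in> polys S V"
  shows "p * q \<in> polys S V"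
  using p
proof (induction rule: polys_sum_induct)
  case zero
  show ?case using S by (auto simp: polys_def dest: is_subringD)
next
  case (add x y)
  then show ?case by (auto simp: distrib_right intro: polys_add is_subringD[OF S])
next
  case (monomial c m)
  show ?case using q
  proof (induction rule: polys_sum_induct)
    case zero
    show ?case using S by (auto simp: polys_def dest: is_subringD)
  next
    case (add x y)
    then show ?case by (auto simp: distrib_left intro: polys_add is_subringD[OF S])
  next
    case (monomial c' m')
    then have "pconst (c * c') * pmonom (m + m') \<in> polys S V"
      using \<open>c \<in> S\<close> \<open>Poly_Mapping.keys m \<subseteq> V\<close> keys_add[of m m']
      by (intro polys_monomial is_subringD[OF S]) auto
    then show ?case by (simp add: pconst_mult pmonom_add mult_ac)
  qed
qed

lemma is_subring_polys:
  assumes S: "is_subring S"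
  shows "is_subring (polys S V)"
proof -
  have "x - y \<in> polys S V" if "x \<in> polys S V" "y \<in> polys S V" for x y
    using that keys_diff[of x y] is_subringD[OF S] by (fastforce simp: polys_def lookup_minus)
  moreover have "1 \<in> polys S V"
    using polys_pconst[of 1 S V] is_subringD[OF S] by simp
  ultimately show ?thesis using polys_mult[OF S] by (auto simp: is_subring_def)
qed

text \<open>Multiplicative induction, for properties that only need to be known on coefficients and
  indeterminates.\<close>

lemma polys_ring_induct [consumes 2, case_names const var add mult]:
  fixes S :: "'a::comm_ring_1 set" and V :: "'v set"
  assumes p: "p \<in> polys S V" and S: "is_subring S"
    and const: "\<And>c. c \<in> S \<Longrightarrow> Q (pconst c)" and var: "\<And>v. v \<in> V \<Longrightarrow> Q (pvar v)"
    and add: "\<And>x y. Q x \<Longrightarrow> Q y \<Longrightarrow> Q (x + y)"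
    and mult: "\<And>x y. Q x \<Longrightarrow> Q y \<Longrightarrow> Q (x * y)"
  shows "Q p"
  using p
proof (induction rule: polys_sum_induct)
  case zero
  show ?case using const[of 0] is_subringD[OF S] by simp
next
  case (monomial c m)
  have one: "Q 1" using const[of 1] is_subringD[OF S] by simp
  have pow: "Q (x ^ k)" if "Q x" for x k
    by (induction k) (auto intro: one mult that)
  have prod: "Q (prod f I)" if "\<And>i. i \<in> I \<Longrightarrow> Q (f i)" for f and I :: "'v set"
    using that by (induction I rule: infinite_finite_induct) (auto intro: one mult)
  show ?case
    unfolding pmonom_eq_prod_pvar using monomial by (intro mult const prod pow var) auto
qed (rule add)

section \<open>Evaluation of polynomials\<close>

definition is_ring_map :: "('a::comm_ring_1 \<Rightarrow> 'b::comm_ring_1) \<Rightarrow> bool" where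
  "is_ring_map \<phi> \<longleftrightarrow> \<phi> 1 = 1 \<and> (\<forall>x y. \<phi> (x + y) = \<phi> x + \<phi> y) \<and> (\<forall>x y. \<phi> (x * y) = \<phi> x * \<phi> y)"

lemma is_ring_mapD:
  assumes "is_ring_map \<phi>"
  shows "\<phi> 1 = 1" "\<phi> 0 = 0" "\<phi> (x + y) = \<phi> x + \<phi> y" "\<phi> (x * y) = \<phi> x * \<phi> y"
proof -
  show "\<phi> 1 = 1" and add: "\<phi> (x + y) = \<phi> x + \<phi> y" and "\<phi> (x * y) = \<phi> x * \<phi> y" for x y
    using assms by (auto simp: is_ring_map_def)
  show "\<phi> 0 = 0" using add[of 0 0] by simp
qed

lemma is_ring_map_pconst [simp]: "is_ring_map pconst"
  by (simp add: is_ring_map_def pconst_add pconst_mult)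

lemma is_ring_map_to_fract [simp]: "is_ring_map to_fract"
  by (simp add: is_ring_map_def)

lemma is_ring_map_comp: "is_ring_map \<phi> \<Longrightarrow> is_ring_map \<psi> \<Longrightarrow> is_ring_map (\<lambda>x. \<phi> (\<psi> x))"
  by (simp add: is_ring_map_def)

definition meval :: "('v \<Rightarrow> 'b::comm_ring_1) \<Rightarrow> ('v \<Rightarrow>\<^sub>0 nat) \<Rightarrow> 'b" where
  "meval x m = (\<Prod>v\<in>Poly_Mapping.keys m. x v ^ Poly_Mapping.lookup m v)"

definition peval :: "('a::comm_ring_1 \<Rightarrow> 'b::comm_ring_1) \<Rightarrow> ('v \<Rightarrow> 'b) \<Rightarrow> ('v, 'a) mpoly \<Rightarrow> 'b" where
  "peval \<phi> x p = (\<Sum>m\<in>Poly_Mapping.keys p. \<phi> (Poly_Mapping.lookup p m) * meval x m)"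

lemma meval_superset:
  assumes "finite V" "Poly_Mapping.keys m \<subseteq> V"
  shows "meval x m = (\<Prod>v\<in>V. x v ^ Poly_Mapping.lookup m v)"
  unfolding meval_def using assms by (intro prod.mono_neutral_left) (auto simp: in_keys_iff)

lemma meval_add: "meval x (m + n) = meval x m * meval x n"
proof -
  let ?V = "Poly_Mapping.keys m \<union> Poly_Mapping.keys n"
  have "meval x (m + n) = (\<Prod>v\<in>?V. x v ^ Poly_Mapping.lookup (m + n) v)"
    by (rule meval_superset) (use keys_add[of m n] in auto)
  also have "\<dots> = (\<Prod>v\<in>?V. x v ^ Poly_Mapping.lookup m v) * (\<Prod>v\<in>?V. x v ^ Poly_Mapping.lookup n v)"
    by (simp add: lookup_add power_add prod.distrib)
  also have "\<dots> = meval x m * meval x n"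
    by (simp add: meval_superset[of ?V])
  finally show ?thesis .
qed

lemma peval_superset:
  assumes "is_ring_map \<phi>" "finite M" "Poly_Mapping.keys p \<subseteq> M"
  shows "peval \<phi> x p = (\<Sum>m\<in>M. \<phi> (Poly_Mapping.lookup p m) * meval x m)"
  unfolding peval_def using assms
  by (intro sum.mono_neutral_left) (auto simp: in_keys_iff is_ring_mapD)

lemma peval_monomial:
  assumes "is_ring_map \<phi>"
  shows "peval \<phi> x (pconst c * pmonom m) = \<phi> c * meval x m"
  using peval_superset[OF assms, of "{m}" "pconst c * pmonom m"]
  by (simp add: pconst_mult_pmonom)

lemma peval_pconst: "is_ring_map \<phi> \<Longrightarrow> peval \<phi> x (pconst c) = \<phi> c"
  using peval_monomial[of \<phi> x c 0] by (simp add: meval_def)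

lemma peval_pvar: "is_ring_map \<phi> \<Longrightarrow> peval \<phi> x (pvar v) = x v"
  using peval_monomial[of \<phi> x 1 "Poly_Mapping.single v 1"]
  by (simp add: meval_def pvar_def is_ring_mapD)

lemma is_ring_map_peval:
  assumes \<phi>: "is_ring_map \<phi>"
  shows "is_ring_map (peval \<phi> x)"
proof -
  have add: "peval \<phi> x (p + q) = peval \<phi> x p + peval \<phi> x q" for p q
  proof -
    let ?M = "Poly_Mapping.keys p \<union> Poly_Mapping.keys q"
    have "Poly_Mapping.keys (p + q) \<subseteq> ?M" by (rule keys_add)
    then show ?thesis
      by (simp add: peval_superset[OF \<phi>, of ?M] lookup_add is_ring_mapD[OF \<phi>] distrib_right sum.distrib)
  qed
  have zero: "peval \<phi> x 0 = 0" by (simp add: peval_def)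
  have "peval \<phi> x (p * q) = peval \<phi> x p * peval \<phi> x q" for p q
  proof -
    have "p \<in> polys UNIV UNIV" by (simp add: polys_def)
    then show ?thesis
    proof (induction rule: polys_sum_induct)
      case (monomial c m)
      have "q \<in> polys UNIV UNIV" by (simp add: polys_def)
      then show ?case
      proof (induction rule: polys_sum_induct)
        case (monomial c' m')
        have "pconst c * pmonom m * (pconst c' * pmonom m') = pconst (c * c') * pmonom (m + m')"
          by (simp add: pconst_mult pmonom_add mult_ac)
        then show ?case
          by (simp only: peval_monomial[OF \<phi>] meval_add is_ring_mapD[OF \<phi>]) (simp add: mult_ac)
      qed (auto simp: zero add distrib_left)
    qed (auto simp: zero add distrib_right)
  qed
  with add show ?thesis using peval_pconst[OF \<phi>, of x 1] by (simp add: is_ring_map_def is_ring_mapD[OF \<phi>])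
qed

lemma ring_map_polys_eqI:
  assumes p: "p \<in> polys S V" and S: "is_subring S" and "is_ring_map \<phi>" "is_ring_map \<psi>"
    and "\<And>c. c \<in> S \<Longrightarrow> \<phi> (pconst c) = \<psi> (pconst c)" "\<And>v. v \<in> V \<Longrightarrow> \<phi> (pvar v) = \<psi> (pvar v)"
  shows "\<phi> p = \<psi> p"
  using p S by (induction rule: polys_ring_induct) (use assms(3-) in \<open>auto simp: is_ring_mapD\<close>)

section \<open>Localization of a domain and its fraction field\<close>

lemma ring_on_simps [simp]:
  "carrier (ring_on S) = S" "x \<otimes>\<^bsub>ring_on S\<^esub> y = x * y" "x \<oplus>\<^bsub>ring_on S\<^esub> y = x + y"
  "\<one>\<^bsub>ring_on S\<^esub> = 1" "\<zero>\<^bsub>ring_on S\<^esub> = 0"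
  by (simp_all add: ring_on_def)

lemma cring_ring_on:
  assumes "is_subring S"
  shows "cring (ring_on S)"
proof (rule cringI)
  show "abelian_group (ring_on S)"
  proof (rule abelian_groupI)
    show "\<exists>y\<in>carrier (ring_on S). y \<oplus>\<^bsub>ring_on S\<^esub> x = \<zero>\<^bsub>ring_on S\<^esub>" if "x \<in> carrier (ring_on S)" for x
      using that is_subringD(5)[OF assms, of x] by (auto intro!: bexI[of _ "- x"])
  qed (auto simp: is_subringD[OF assms])
  show "comm_monoid (ring_on S)"
    by (rule comm_monoidI) (auto simp: is_subringD[OF assms])
qed (auto simp: algebra_simps)

lemma a_inv_ring_on:
  assumes S: "is_subring S" and "x \<in> S"
  shows "\<ominus>\<^bsub>ring_on S\<^esub> x = - x"
proof -
  interpret cring "ring_on S" by (rule cring_ring_on[OF S])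
  show ?thesis by (rule minus_equality) (use assms is_subringD[OF S] in auto)
qed

lemma minus_ring_on:
  "is_subring S \<Longrightarrow> y \<in> S \<Longrightarrow> x \<ominus>\<^bsub>ring_on S\<^esub> y = x - y"
  by (simp add: a_minus_def a_inv_ring_on)

lemma ideal_ring_onI:
  assumes S: "is_subring S" and "I \<subseteq> S" "0 \<in> I" "\<And>x y. x \<in> I \<Longrightarrow> y \<in> I \<Longrightarrow> x + y \<in> I"
    "\<And>x y. x \<in> S \<Longrightarrow> y \<in> I \<Longrightarrow> x * y \<in> I"
  shows "ideal I (ring_on S)"
proof (rule idealI)
  interpret cring "ring_on S" by (rule cring_ring_on[OF S])
  show "ring (ring_on S)" by unfold_locales
  have "\<ominus>\<^bsub>ring_on S\<^esub> x \<in> I" if "x \<in> I" for x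
    using assms(5)[of "- 1" x] that assms(2) is_subringD[OF S] by (auto simp: a_inv_ring_on[OF S])
  then show "subgroup I (add_monoid (ring_on S))"
    using assms by (intro subgroup.intro) (auto simp: a_inv_def)
  show "x \<otimes>\<^bsub>ring_on S\<^esub> a \<in> I" and "a \<otimes>\<^bsub>ring_on S\<^esub> x \<in> I" if "a \<in> I" "x \<in> carrier (ring_on S)" for a x
    using assms(5)[of x a] that by (simp_all add: mult.commute)
qed

lemma nat_pow_ring_on: "x [^]\<^bsub>ring_on S\<^esub> (k::nat) = x ^ k"
  by (induction k) (auto simp: mult.commute)

lemma powers_ring_on: "powers (ring_on S) x = range (\<lambda>k. x ^ k)"
  by (auto simp: powers_def nat_pow_ring_on)

text \<open>The embedding of a localization of a domain into the fraction field.  A class is never empty,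
  and all its pairs have the same quotient, so the choice is harmless.\<close>

definition frac_value :: "('a::idom \<times> 'a) set \<Rightarrow> 'a fract" where
  "frac_value X = (case SOME p. p \<in> X of (a, s) \<Rightarrow> to_fract a / to_fract s)"

text \<open>Sums and products of classes are unions over representatives; this collapses such a union
  once the value is known not to depend on the representatives.\<close>

lemma UN_pairs_const:
  assumes "p \<in> X" "q \<in> Y" "\<And>a s b t. (a, s) \<in> X \<Longrightarrow> (b, t) \<in> Y \<Longrightarrow> g a s b t = c"
  shows "(\<Union>(a, s)\<in>X. \<Union>(b, t)\<in>Y. g a s b t) = c"
proof -
  have "(\<Union>(b, t)\<in>Y. g a s b t) = c" if "(a, s) \<in> X" for a s
    using assms(2) assms(3)[OF that] by (intro SUP_eq_const) auto
  then have "(case x of (a, s) \<Rightarrow> \<Union>(b, t)\<in>Y. g a s b t) = c" if "x \<in> X" for x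
    using that by (cases x) simp
  then show ?thesis using assms(1) by (intro SUP_eq_const) auto
qed

context
  fixes S M :: "'a::idom set"
  assumes S: "is_subring S" and M: "M \<subseteq> S" "0 \<notin> M" "1 \<in> M" "\<And>x y. x \<in> M \<Longrightarrow> y \<in> M \<Longrightarrow> x * y \<in> M"
begin

lemma loc_frac_ring_on:
  assumes "a \<in> S" "s \<in> M"
  shows "loc_frac (ring_on S) M a s = {(b, t). b \<in> S \<and> t \<in> M \<and> to_fract b / to_fract t = to_fract a / to_fract s}"
proof -
  have *: "(\<exists>u\<in>M. u * (a * t - b * s) = 0) \<longleftrightarrow> to_fract b / to_fract t = to_fract a / to_fract s"
    if "t \<in> M" for b t
  proof -
    have "s \<noteq> 0" "t \<noteq> 0" using that assms M by auto
    then have "to_fract b / to_fract t = to_fract a / to_fract s \<longleftrightarrow> to_fract (b * s) = to_fract (a * t)"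
      unfolding to_fract_mult by (simp add: frac_eq_eq)
    also have "\<dots> \<longleftrightarrow> a * t - b * s = 0" unfolding to_fract_eq_iff by auto
    finally show ?thesis using M by auto
  qed
  have "a * t \<ominus>\<^bsub>ring_on S\<^esub> b * s = a * t - b * s" if "b \<in> S" "t \<in> M" for b t
    using that assms M by (intro minus_ring_on[OF S] is_subringD[OF S]) auto
  then show ?thesis
    unfolding loc_frac_def loc_rel_def using assms by (auto simp flip: *)
qed

lemma frac_value_loc_frac:
  assumes "a \<in> S" "s \<in> M"
  shows "frac_value (loc_frac (ring_on S) M a s) = to_fract a / to_fract s"
proof -
  have "(SOME p. p \<in> loc_frac (ring_on S) M a s) \<in> loc_frac (ring_on S) M a s"
    by (rule someI[of _ "(a, s)"]) (simp add: loc_frac_ring_on assms)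
  then show ?thesis by (auto simp: frac_value_def loc_frac_ring_on assms)
qed

lemma carrier_localization_cases:
  assumes "x \<in> carrier (localization (ring_on S) M)"
  obtains a s where "a \<in> S" "s \<in> M" "x = loc_frac (ring_on S) M a s"
  using assms by (auto simp: localization_def quotient_def loc_frac_def)

lemma loc_frac_in_carrier:
  assumes "a \<in> S" "s \<in> M"
  shows "loc_frac (ring_on S) M a s \<in> carrier (localization (ring_on S) M)"
  using assms by (auto simp: localization_def quotient_def loc_frac_def)

lemma loc_frac_mult:
  assumes "a \<in> S" "s \<in> M" "b \<in> S" "t \<in> M"
  shows "loc_frac (ring_on S) M a s \<otimes>\<^bsub>localization (ring_on S) M\<^esub> loc_frac (ring_on S) M b t =
    loc_frac (ring_on S) M (a * b) (s * t)"
proof -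
  let ?c = "loc_frac (ring_on S) M (a * b) (s * t)"
  have *: "loc_frac (ring_on S) M (a' * b') (s' * t') = ?c"
    if "(a', s') \<in> loc_frac (ring_on S) M a s" "(b', t') \<in> loc_frac (ring_on S) M b t" for a' s' b' t'
  proof -
    have mem: "a' \<in> S" "s' \<in> M" "b' \<in> S" "t' \<in> M"
      and eq: "to_fract a' / to_fract s' = to_fract a / to_fract s"
        "to_fract b' / to_fract t' = to_fract b / to_fract t"
      using that assms by (auto simp: loc_frac_ring_on)
    have "to_fract (x * y) / to_fract (u * v) = to_fract x / to_fract u * (to_fract y / to_fract v)"
      for x u y v :: 'a by simp
    then have "to_fract (a' * b') / to_fract (s' * t') = to_fract (a * b) / to_fract (s * t)"
      using eq by presburger
    then show ?thesis using assms mem M S by (simp add: loc_frac_ring_on is_subringD)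
  qed
  have "(a, s) \<in> loc_frac (ring_on S) M a s" "(b, t) \<in> loc_frac (ring_on S) M b t"
    using assms by (auto simp: loc_frac_ring_on)
  from this * have "(\<Union>(a', s')\<in>loc_frac (ring_on S) M a s. \<Union>(b', t')\<in>loc_frac (ring_on S) M b t.
      loc_frac (ring_on S) M (a' * b') (s' * t')) = ?c"
    by (rule UN_pairs_const)
  then show ?thesis by (simp add: localization_def)
qed

lemma loc_frac_add:
  assumes "a \<in> S" "s \<in> M" "b \<in> S" "t \<in> M"
  shows "loc_frac (ring_on S) M a s \<oplus>\<^bsub>localization (ring_on S) M\<^esub> loc_frac (ring_on S) M b t =
    loc_frac (ring_on S) M (a * t + b * s) (s * t)"
proof -
  let ?c = "loc_frac (ring_on S) M (a * t + b * s) (s * t)"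
  have nz: "x \<noteq> 0" if "x \<in> M" for x using that M by auto
  have *: "loc_frac (ring_on S) M (a' * t' + b' * s') (s' * t') = ?c"
    if "(a', s') \<in> loc_frac (ring_on S) M a s" "(b', t') \<in> loc_frac (ring_on S) M b t" for a' s' b' t'
  proof -
    have mem: "a' \<in> S" "s' \<in> M" "b' \<in> S" "t' \<in> M"
      and eq: "to_fract a' / to_fract s' = to_fract a / to_fract s"
        "to_fract b' / to_fract t' = to_fract b / to_fract t"
      using that assms by (auto simp: loc_frac_ring_on)
    have "to_fract (x * v + y * u) / to_fract (u * v) = to_fract x / to_fract u + to_fract y / to_fract v"
      if "u \<in> M" "v \<in> M" for x u y v
      using that nz[of u] nz[of v] by (simp add: add_frac_eq)
    then have "to_fract (a' * t' + b' * s') / to_fract (s' * t') = to_fract (a * t + b * s) / to_fract (s * t)"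
      using assms mem eq by presburger
    moreover have "x * v + y * u \<in> S" if "x \<in> S" "y \<in> S" "u \<in> M" "v \<in> M" for x y u v
      using that M S by (auto intro!: is_subringD)
    ultimately show ?thesis using assms mem M by (simp add: loc_frac_ring_on)
  qed
  have "(a, s) \<in> loc_frac (ring_on S) M a s" "(b, t) \<in> loc_frac (ring_on S) M b t"
    using assms by (auto simp: loc_frac_ring_on)
  from this * have "(\<Union>(a', s')\<in>loc_frac (ring_on S) M a s. \<Union>(b', t')\<in>loc_frac (ring_on S) M b t.
      loc_frac (ring_on S) M (a' * t' + b' * s') (s' * t')) = ?c"
    by (rule UN_pairs_const)
  then show ?thesis by (simp add: localization_def)
qed

text \<open>Over a domain \<open>(a, s)\<close> and \<open>(b, t)\<close> are equivalent exactly when \<open>a / s = b / t\<close>, so the embedding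
  is injective and computations in the localization, including the formation of inverses, can be
  carried out in the fraction field.\<close>

lemma frac_value_inj:
  assumes "x \<in> carrier (localization (ring_on S) M)" "y \<in> carrier (localization (ring_on S) M)"
    "frac_value x = frac_value y"
  shows "x = y"
proof -
  obtain a s b t where "a \<in> S" "s \<in> M" "x = loc_frac (ring_on S) M a s"
    "b \<in> S" "t \<in> M" "y = loc_frac (ring_on S) M b t"
    using assms by (metis carrier_localization_cases)
  with assms(3) show ?thesis by (simp add: frac_value_loc_frac) (simp add: loc_frac_ring_on)
qed

lemma frac_value_mult:
  assumes "x \<in> carrier (localization (ring_on S) M)" "y \<in> carrier (localization (ring_on S) M)"
  shows "x \<otimes>\<^bsub>localization (ring_on S) M\<^esub> y \<in> carrier (localization (ring_on S) M)"
    "frac_value (x \<otimes>\<^bsub>localization (ring_on S) M\<^esub> y) = frac_value x * frac_value y"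
proof -
  obtain a s b t where *: "a \<in> S" "s \<in> M" "x = loc_frac (ring_on S) M a s"
    "b \<in> S" "t \<in> M" "y = loc_frac (ring_on S) M b t"
    using assms by (metis carrier_localization_cases)
  then have "a * b \<in> S" "s * t \<in> M" using M S by (auto simp: is_subringD)
  with * show "x \<otimes>\<^bsub>localization (ring_on S) M\<^esub> y \<in> carrier (localization (ring_on S) M)"
    "frac_value (x \<otimes>\<^bsub>localization (ring_on S) M\<^esub> y) = frac_value x * frac_value y"
    by (simp_all add: loc_frac_mult loc_frac_in_carrier frac_value_loc_frac)
qed

lemma frac_value_add:
  assumes "x \<in> carrier (localization (ring_on S) M)" "y \<in> carrier (localization (ring_on S) M)"
  shows "frac_value (x \<oplus>\<^bsub>localization (ring_on S) M\<^esub> y) = frac_value x + frac_value y"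
proof -
  obtain a s b t where *: "a \<in> S" "s \<in> M" "x = loc_frac (ring_on S) M a s"
    "b \<in> S" "t \<in> M" "y = loc_frac (ring_on S) M b t"
    using assms by (metis carrier_localization_cases)
  then have "a * t + b * s \<in> S" "s * t \<in> M" using M S by (auto intro!: is_subringD)
  moreover have "s \<noteq> 0" "t \<noteq> 0" using * M by auto
  ultimately show ?thesis using *
    by (simp add: loc_frac_add frac_value_loc_frac add_frac_eq)
qed

lemma frac_value_one: "frac_value \<one>\<^bsub>localization (ring_on S) M\<^esub> = 1"
  and one_in_localization: "\<one>\<^bsub>localization (ring_on S) M\<^esub> \<in> carrier (localization (ring_on S) M)"
  using frac_value_loc_frac[of 1 1] loc_frac_in_carrier[of 1 1] M S
  by (auto simp: localization_def is_subringD)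

lemma frac_value_zero: "frac_value \<zero>\<^bsub>localization (ring_on S) M\<^esub> = 0"
  and zero_in_localization: "\<zero>\<^bsub>localization (ring_on S) M\<^esub> \<in> carrier (localization (ring_on S) M)"
  using frac_value_loc_frac[of 0 1] loc_frac_in_carrier[of 0 1] M S
  by (auto simp: localization_def is_subringD)

lemma frac_value_inv:
  assumes x: "x \<in> carrier (localization (ring_on S) M)" and y: "y \<in> carrier (localization (ring_on S) M)"
    and "frac_value x * frac_value y = 1"
  shows "inv\<^bsub>localization (ring_on S) M\<^esub> x = y"
proof -
  let ?L = "localization (ring_on S) M"
  have iff: "x \<otimes>\<^bsub>?L\<^esub> z = \<one>\<^bsub>?L\<^esub> \<longleftrightarrow> frac_value x * frac_value z = 1"
    "z \<otimes>\<^bsub>?L\<^esub> x = \<one>\<^bsub>?L\<^esub> \<longleftrightarrow> frac_value x * frac_value z = 1"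
    if "z \<in> carrier ?L" for z
    using frac_value_inj[OF _ one_in_localization] frac_value_mult[OF x that] frac_value_mult[OF that x]
    by (metis frac_value_one mult.commute)+
  have "frac_value z = frac_value y" if "frac_value x * frac_value z = 1" for z
    using that assms(3) by (metis mult.left_commute mult.right_neutral)
  then have "z = y" if "z \<in> carrier ?L" "x \<otimes>\<^bsub>?L\<^esub> z = \<one>\<^bsub>?L\<^esub>" for z
    using that y iff(1) frac_value_inj by blast
  moreover have "x \<otimes>\<^bsub>?L\<^esub> y = \<one>\<^bsub>?L\<^esub>" "y \<otimes>\<^bsub>?L\<^esub> x = \<one>\<^bsub>?L\<^esub>"
    using iff[OF y] assms(3) by simp_all
  ultimately show ?thesis
    unfolding m_inv_def using y by (intro the_equality) blast+
qed

end

section \<open>The kernel of a localization map\<close>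

text \<open>Here zero divisors are allowed, as they occur in \<open>B\<close>.  If \<open>u a = 0\<close>, then multiplying a
  witness by \<open>u\<close> turns an equivalence with \<open>(a, 1)\<close> into one with \<open>(0, 1)\<close> and conversely, so the
  two classes agree.\<close>

lemma loc_frac_eq_zero_iff:
  assumes "cring R" "M \<subseteq> carrier R" "\<one>\<^bsub>R\<^esub> \<in> M"
    "\<And>x y. x \<in> M \<Longrightarrow> y \<in> M \<Longrightarrow> x \<otimes>\<^bsub>R\<^esub> y \<in> M" "a \<in> carrier R"
  shows "loc_frac R M a \<one>\<^bsub>R\<^esub> = loc_frac R M \<zero>\<^bsub>R\<^esub> \<one>\<^bsub>R\<^esub> \<longleftrightarrow> (\<exists>u\<in>M. u \<otimes>\<^bsub>R\<^esub> a = \<zero>\<^bsub>R\<^esub>)"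
proof -
  interpret cring R by fact
  note M = assms(2-4) and a = assms(5)
  have eq: "loc_frac R M b \<one>\<^bsub>R\<^esub> = {(c, t). c \<in> carrier R \<and> t \<in> M \<and> (\<exists>u\<in>M. u \<otimes>\<^bsub>R\<^esub> (b \<otimes>\<^bsub>R\<^esub> t \<ominus>\<^bsub>R\<^esub> c) = \<zero>\<^bsub>R\<^esub>)}"
    if "b \<in> carrier R" for b
    using that M by (auto simp: loc_frac_def loc_rel_def)
  show ?thesis
  proof
    assume h: "loc_frac R M a \<one>\<^bsub>R\<^esub> = loc_frac R M \<zero>\<^bsub>R\<^esub> \<one>\<^bsub>R\<^esub>"
    have "(\<zero>\<^bsub>R\<^esub>, \<one>\<^bsub>R\<^esub>) \<in> loc_frac R M \<zero>\<^bsub>R\<^esub> \<one>\<^bsub>R\<^esub>"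
      using M by (auto simp: eq minus_eq intro!: bexI[of _ "\<one>\<^bsub>R\<^esub>"])
    then have "(\<zero>\<^bsub>R\<^esub>, \<one>\<^bsub>R\<^esub>) \<in> loc_frac R M a \<one>\<^bsub>R\<^esub>" using h by simp
    then show "\<exists>u\<in>M. u \<otimes>\<^bsub>R\<^esub> a = \<zero>\<^bsub>R\<^esub>" using a by (auto simp: eq minus_eq)
  next
    assume "\<exists>u\<in>M. u \<otimes>\<^bsub>R\<^esub> a = \<zero>\<^bsub>R\<^esub>"
    then obtain u where u: "u \<in> M" "u \<otimes>\<^bsub>R\<^esub> a = \<zero>\<^bsub>R\<^esub>" by auto
    have uv: "(v \<otimes>\<^bsub>R\<^esub> u) \<otimes>\<^bsub>R\<^esub> (a \<otimes>\<^bsub>R\<^esub> t \<ominus>\<^bsub>R\<^esub> c) = (v \<otimes>\<^bsub>R\<^esub> u) \<otimes>\<^bsub>R\<^esub> (\<zero>\<^bsub>R\<^esub> \<otimes>\<^bsub>R\<^esub> t \<ominus>\<^bsub>R\<^esub> c)"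
      if "v \<in> M" "t \<in> M" "c \<in> carrier R" for v t c
    proof -
      have mem: "u \<in> carrier R" "v \<in> carrier R" "t \<in> carrier R" using that u M by auto
      have "u \<otimes>\<^bsub>R\<^esub> (a \<otimes>\<^bsub>R\<^esub> t \<ominus>\<^bsub>R\<^esub> c) = (u \<otimes>\<^bsub>R\<^esub> a) \<otimes>\<^bsub>R\<^esub> t \<ominus>\<^bsub>R\<^esub> u \<otimes>\<^bsub>R\<^esub> c"
        using mem that a by algebra
      also have "\<dots> = u \<otimes>\<^bsub>R\<^esub> (\<zero>\<^bsub>R\<^esub> \<otimes>\<^bsub>R\<^esub> t \<ominus>\<^bsub>R\<^esub> c)" using u mem that by (simp add: minus_eq r_minus)
      finally show ?thesis using mem that a by (simp add: m_assoc)
    qed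
    have shift: "v \<otimes>\<^bsub>R\<^esub> u \<otimes>\<^bsub>R\<^esub> x = \<zero>\<^bsub>R\<^esub>" if "v \<in> M" "x \<in> carrier R" "v \<otimes>\<^bsub>R\<^esub> x = \<zero>\<^bsub>R\<^esub>" for v x
    proof -
      have mem: "u \<in> carrier R" "v \<in> carrier R" using that u M by auto
      have "v \<otimes>\<^bsub>R\<^esub> u \<otimes>\<^bsub>R\<^esub> x = u \<otimes>\<^bsub>R\<^esub> (v \<otimes>\<^bsub>R\<^esub> x)" using mem that by (simp add: m_ac)
      then show ?thesis using that mem by simp
    qed
    have "(\<exists>v\<in>M. v \<otimes>\<^bsub>R\<^esub> (a \<otimes>\<^bsub>R\<^esub> t \<ominus>\<^bsub>R\<^esub> c) = \<zero>\<^bsub>R\<^esub>) \<longleftrightarrow>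
        (\<exists>v\<in>M. v \<otimes>\<^bsub>R\<^esub> (\<zero>\<^bsub>R\<^esub> \<otimes>\<^bsub>R\<^esub> t \<ominus>\<^bsub>R\<^esub> c) = \<zero>\<^bsub>R\<^esub>)" if tc: "t \<in> M" "c \<in> carrier R" for t c
    proof -
      have mem: "a \<otimes>\<^bsub>R\<^esub> t \<ominus>\<^bsub>R\<^esub> c \<in> carrier R" "\<zero>\<^bsub>R\<^esub> \<otimes>\<^bsub>R\<^esub> t \<ominus>\<^bsub>R\<^esub> c \<in> carrier R"
        using tc M a by (auto intro!: minus_closed m_closed)
      show ?thesis
        using shift[OF _ mem(1)] shift[OF _ mem(2)] uv[OF _ tc] assms(4)[OF _ u(1)] by metis
    qed
    then show "loc_frac R M a \<one>\<^bsub>R\<^esub> = loc_frac R M \<zero>\<^bsub>R\<^esub> \<one>\<^bsub>R\<^esub>"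
      unfolding eq[OF a] eq[OF zero_closed] by blast
  qed
qed

lemma bex_powers: "(\<exists>u\<in>powers R x. P u) \<longleftrightarrow> (\<exists>k::nat. P (x [^]\<^bsub>R\<^esub> k))"
  unfolding powers_def by (rule iffI; elim bexE exE; simp; blast)

lemma powers_submonoid:
  assumes "cring R" "x \<in> carrier R"
  shows "powers R x \<subseteq> carrier R" "\<one>\<^bsub>R\<^esub> \<in> powers R x"
    "y \<in> powers R x \<Longrightarrow> z \<in> powers R x \<Longrightarrow> y \<otimes>\<^bsub>R\<^esub> z \<in> powers R x"
proof -
  interpret cring R by fact
  show "powers R x \<subseteq> carrier R" using assms(2) by (auto simp: powers_def)
  have "x [^]\<^bsub>R\<^esub> (0::nat) = \<one>\<^bsub>R\<^esub>" by simp
  then show "\<one>\<^bsub>R\<^esub> \<in> powers R x" unfolding powers_def by (metis (mono_tags) mem_Collect_eq)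
  show "y \<in> powers R x \<Longrightarrow> z \<in> powers R x \<Longrightarrow> y \<otimes>\<^bsub>R\<^esub> z \<in> powers R x"
    using nat_pow_mult[OF assms(2)] unfolding powers_def by (auto simp del: nat_pow_mult)
qed

lemma zero_localization: "\<zero>\<^bsub>localization R S\<^esub> = loc_frac R S \<zero>\<^bsub>R\<^esub> \<one>\<^bsub>R\<^esub>"
  by (simp add: localization_def)

lemma zero_product_ring: "\<zero>\<^bsub>product_ring I R\<^esub> = (\<lambda>i\<in>I. \<zero>\<^bsub>R i\<^esub>)"
  by (simp add: product_ring_def)

lemma restrict_eq_iff: "restrict f I = restrict g I \<longleftrightarrow> (\<forall>x\<in>I. f x = g x)"
proof
  assume eq: "restrict f I = restrict g I"
  show "\<forall>x\<in>I. f x = g x"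
  proof
    fix x assume "x \<in> I"
    then show "f x = g x" using fun_cong[OF eq, of x] by simp
  qed
qed (auto intro: restrict_ext)

section \<open>Generic forms\<close>

context
  fixes s r :: nat and n :: "nat \<Rightarrow> nat" and d :: "nat \<Rightarrow> nat \<Rightarrow> nat"
begin

text \<open>The chart \<open>\<iota> = (i\<^sub>1, \<dots>, i\<^sub>s)\<close> singles out the indeterminates \<open>X\<^bsub>j,\<iota> j\<^esub>\<close>.  The multi-exponent
  \<open>vexp \<iota> e\<close> is that of \<open>\<Prod>\<^sub>j X\<^bsub>j,\<iota> j\<^esub>^(e j)\<close>; for \<open>e = d i\<close> this product is the analogue of \<open>\<tau>\<^sub>i\<close> in the
  chart, and its coefficient in \<open>f\<^sub>i\<close> the analogue of \<open>\<epsilon>\<^sub>i\<close>.\<close>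

definition vexp :: "(nat \<Rightarrow> nat) \<Rightarrow> (nat \<Rightarrow> nat) \<Rightarrow> mexp" where
  "vexp \<iota> e = (\<Sum>j=1..s. Poly_Mapping.single (j, \<iota> j) (e j))"

text \<open>What is left of \<open>f\<^sub>i\<close> when its term \<open>\<epsilon>\<^sub>i \<tau>\<^sub>i\<close> in the chart \<open>\<iota>\<close> is removed.\<close>

definition g_poly :: "(nat \<Rightarrow> nat) \<Rightarrow> nat \<Rightarrow> 'k::idom C_poly" where
  "g_poly \<iota> i = (\<Sum>\<alpha>\<in>mexps s n (d i) - {vexp \<iota> (d i)}. pconst (pvar (i, \<alpha>)) * pmonom \<alpha>)"

text \<open>The ring \<open>A'[X]\<close> of the chart \<open>\<iota>\<close>: the elements of \<open>C\<close> that involve none of the \<open>\<epsilon>\<^sub>i\<close> of the chart.\<close>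

definition eps_free :: "(nat \<Rightarrow> nat) \<Rightarrow> 'k::idom C_poly set" where
  "eps_free \<iota> = polys (polys UNIV (U_idx s n r d - (\<lambda>i. (i, vexp \<iota> (d i))) ` {1..r})) (X_idx s n)"

lemma lookup_vexp:
  "Poly_Mapping.lookup (vexp \<iota> e) (j, k) = (if j \<in> {1..s} \<and> k = \<iota> j then e j else 0)"
proof -
  have "Poly_Mapping.lookup (vexp \<iota> e) (j, k) =
      (\<Sum>j'=1..s. if j' = j then (if k = \<iota> j then e j else 0) else 0)"
    unfolding vexp_def lookup_sum
    by (intro sum.cong) (auto simp: lookup_single when_def)
  also have "\<dots> = (if j \<in> {1..s} \<and> k = \<iota> j then e j else 0)"
    by (subst sum.delta) auto
  finally show ?thesis .
qed

lemma vexp_add: "vexp \<iota> e + vexp \<iota> e' = vexp \<iota> (\<lambda>j. e j + e' j)"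
  by (simp add: vexp_def single_add sum.distrib)

lemma prod_pvar_power: "(\<Prod>j=1..s. pvar (j, \<iota> j) ^ e j) = pmonom (vexp \<iota> e)"
  by (simp add: vexp_def pmonom_sum pvar_power)

lemma sigma_poly_power: "sigma_poly s \<iota> ^ k = pmonom (vexp \<iota> (\<lambda>j. k))"
  unfolding sigma_poly_def prod_power_distrib[symmetric] prod_pvar_power[symmetric] by simp

lemma sigma_poly_neq_0: "sigma_poly s \<iota> ^ k \<noteq> 0"
  by (simp add: sigma_poly_power)

lemma sigma_q_eq: "sigma_q s n = sigma_poly s (\<lambda>j\<in>{1..s}. n j + 1)"
  by (simp add: sigma_q_def sigma_poly_def)

lemma tau_exp_eq: "tau_exp s n d i = vexp (\<lambda>j\<in>{1..s}. n j + 1) (d i)"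
  by (simp add: tau_exp_def vexp_def)

lemma is_subring_A_set: "is_subring (A_set s n r d)"
  by (simp add: A_set_def is_subring_polys)

lemma is_subring_C_set: "is_subring (C_set s n r d)"
  by (simp add: C_set_def is_subring_polys is_subring_A_set)

lemma is_subring_eps_free: "is_subring (eps_free \<iota>)"
  by (simp add: eps_free_def is_subring_polys)

lemma eps_free_subset: "eps_free \<iota> \<subseteq> C_set s n r d"
  unfolding eps_free_def C_set_def A_set_def by (intro polys_mono) auto

lemma last_in_sigma_idx: "(\<lambda>j\<in>{1..s}. n j + 1) \<in> sigma_idx s n"
  by (auto simp: sigma_idx_def)

lemma f_poly_in_C_set:
  assumes "i \<in> {1..r}"
  shows "f_poly s n d i \<in> C_set s n r d"
  unfolding f_poly_def
proof (intro is_subring_sum is_subring_C_set)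
  fix \<alpha> assume "\<alpha> \<in> mexps s n (d i)"
  then show "pconst (pvar (i, \<alpha>)) * pmonom \<alpha> \<in> (C_set s n r d :: 'k::idom C_poly set)"
    unfolding C_set_def A_set_def using assms
    by (intro polys_monomial polys_pvar is_subringD[OF is_subring_polys[OF is_subring_UNIV]])
       (auto simp: U_idx_def mexps_def)
qed

context
  fixes \<iota> :: "nat \<Rightarrow> nat"
  assumes \<iota>: "\<iota> \<in> sigma_idx s n"
begin

lemma keys_vexp: "Poly_Mapping.keys (vexp \<iota> e) \<subseteq> X_idx s n"
  using \<iota> by (auto simp: in_keys_iff lookup_vexp X_idx_def sigma_idx_def PiE_iff split: if_splits)

lemma vexp_in_mexps: "vexp \<iota> e \<in> mexps s n e"
  using \<iota> keys_vexp[of e]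
  by (auto simp: mexps_def lookup_vexp sigma_idx_def PiE_iff Ball_def sum.delta')

lemma f_poly_eq: "f_poly s n d i = pconst (pvar (i, vexp \<iota> (d i))) * pmonom (vexp \<iota> (d i)) + g_poly \<iota> i"
  unfolding f_poly_def g_poly_def by (rule sum.remove[OF finite_mexps vexp_in_mexps])

lemma pmonom_vexp_in_eps_free: "pmonom (vexp \<iota> e) \<in> eps_free \<iota>"
  unfolding eps_free_def
  by (intro polys_pmonom keys_vexp is_subringD[OF is_subring_polys[OF is_subring_UNIV]])

lemma sigma_power_in_eps_free: "sigma_poly s \<iota> ^ k \<in> eps_free \<iota>"
  unfolding sigma_poly_power by (rule pmonom_vexp_in_eps_free)

text \<open>The exponent \<open>N = \<Sum>\<^sub>j d\<^sub>i\<^sub>j\<close> dominates every \<open>d\<^sub>i\<^sub>j\<close>; the cofactor is again a monomial of the chart.\<close>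

lemma tau_dvd_sigma_power:
  shows "\<exists>N. \<exists>e\<in>eps_free \<iota>. e * pmonom (vexp \<iota> (d i)) = (sigma_poly s \<iota> ^ N :: 'k::idom C_poly)"
proof (intro exI bexI)
  let ?N = "\<Sum>j=1..s. d i j"
  have "vexp \<iota> (\<lambda>j. ?N - d i j) + vexp \<iota> (d i) = vexp \<iota> (\<lambda>j. ?N)"
    unfolding vexp_add unfolding vexp_def
    by (intro sum.cong refl arg_cong2[where f = Poly_Mapping.single] le_add_diff_inverse2 member_le_sum) auto
  then show "pmonom (vexp \<iota> (\<lambda>j. ?N - d i j)) * pmonom (vexp \<iota> (d i)) = sigma_poly s \<iota> ^ ?N"
    by (simp add: sigma_poly_power flip: pmonom_add)
qed (rule pmonom_vexp_in_eps_free)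

lemma g_poly_in_eps_free:
  assumes "i \<in> {1..r}"
  shows "g_poly \<iota> i \<in> eps_free \<iota>"
  unfolding g_poly_def
proof (intro is_subring_sum is_subring_eps_free)
  fix \<alpha> assume "\<alpha> \<in> mexps s n (d i) - {vexp \<iota> (d i)}"
  then show "pconst (pvar (i, \<alpha>)) * pmonom \<alpha> \<in> (eps_free \<iota> :: 'k::idom C_poly set)"
    unfolding eps_free_def using assms
    by (intro polys_monomial polys_pvar is_subringD[OF is_subring_polys[OF is_subring_UNIV]])
       (auto simp: U_idx_def mexps_def)
qed

end

section \<open>The ideal of the generic forms\<close>

lemma ideal_f_ideal: "ideal (f_ideal s n r d) (C_ring s n r d :: 'k::idom C_poly ring)"
  and f_poly_in_f_ideal: "i \<in> {1..r} \<Longrightarrow> f_poly s n d i \<in> (f_ideal s n r d :: 'k C_poly set)"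
proof -
  interpret cring "C_ring s n r d :: 'k C_poly ring"
    unfolding C_ring_def by (rule cring_ring_on[OF is_subring_C_set])
  have sub: "f_poly s n d ` {1..r} \<subseteq> carrier (C_ring s n r d)"
    by (auto simp: C_ring_def intro!: f_poly_in_C_set)
  show "ideal (f_ideal s n r d) (C_ring s n r d :: 'k C_poly ring)"
    unfolding f_ideal_def by (rule genideal_ideal[OF sub])
  show "i \<in> {1..r} \<Longrightarrow> f_poly s n d i \<in> (f_ideal s n r d :: 'k C_poly set)"
    unfolding f_ideal_def using genideal_self[OF sub] by auto
qed

lemma f_idealD:
  fixes x y c :: "'k::idom C_poly"
  shows "f_ideal s n r d \<subseteq> (C_set s n r d :: 'k C_poly set)" "0 \<in> (f_ideal s n r d :: 'k C_poly set)"
    "x \<in> f_ideal s n r d \<Longrightarrow> y \<in> f_ideal s n r d \<Longrightarrow> x + y \<in> f_ideal s n r d"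
    "x \<in> f_ideal s n r d \<Longrightarrow> y \<in> f_ideal s n r d \<Longrightarrow> x - y \<in> f_ideal s n r d"
    "c \<in> C_set s n r d \<Longrightarrow> x \<in> f_ideal s n r d \<Longrightarrow> c * x \<in> f_ideal s n r d"
proof -
  interpret ideal "f_ideal s n r d" "C_ring s n r d :: 'k C_poly ring" by (rule ideal_f_ideal)
  have car: "carrier (C_ring s n r d) = (C_set s n r d :: 'k C_poly set)" by (simp add: C_ring_def)
  show sub: "f_ideal s n r d \<subseteq> (C_set s n r d :: 'k C_poly set)" using a_subset by (simp add: car)
  show "0 \<in> (f_ideal s n r d :: 'k C_poly set)"
    using additive_subgroup.zero_closed[OF additive_subgroup_axioms] by (simp add: C_ring_def)
  show add: "x + y \<in> f_ideal s n r d" if "x \<in> f_ideal s n r d" "y \<in> f_ideal s n r d" for x y :: "'k C_poly"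
    using additive_subgroup.a_closed[OF additive_subgroup_axioms that] by (simp add: C_ring_def)
  show mult: "c * x \<in> f_ideal s n r d" if "c \<in> C_set s n r d" "x \<in> f_ideal s n r d" for c x :: "'k C_poly"
    using I_l_closed[of x c] that by (simp add: C_ring_def)
  show "x - y \<in> f_ideal s n r d" if "x \<in> f_ideal s n r d" "y \<in> f_ideal s n r d" for x y :: "'k C_poly"
    using add[OF that(1) mult[OF _ that(2), of "- 1"]]
    by (simp add: is_subringD(1)[OF is_subring_C_set] is_subringD(5)[OF is_subring_C_set])
qed

text \<open>Minimality of the ideal \<open>(f\<^sub>1, \<dots>, f\<^sub>r)\<close>, in the form used for the two homomorphisms that kill
  it: a substitution for the \<open>\<epsilon>\<^sub>i\<close>, and \<open>F \<circ> G\<close>.  The latter is known to be a homomorphism on the carrier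
  only, hence the restriction of the hypotheses to \<open>C\<close>.\<close>

lemma f_ideal_in_kernel:
  fixes \<psi> :: "'k::idom C_poly \<Rightarrow> 'b::comm_ring_1"
  assumes add: "\<And>x y. x \<in> C_set s n r d \<Longrightarrow> y \<in> C_set s n r d \<Longrightarrow> \<psi> (x + y) = \<psi> x + \<psi> y"
    and mult: "\<And>x y. x \<in> C_set s n r d \<Longrightarrow> y \<in> C_set s n r d \<Longrightarrow> \<psi> (x * y) = \<psi> x * \<psi> y"
    and f: "\<And>i. i \<in> {1..r} \<Longrightarrow> \<psi> (f_poly s n d i) = 0"
    and c: "c \<in> f_ideal s n r d"
  shows "\<psi> c = 0"
proof -
  let ?I = "{c \<in> C_set s n r d. \<psi> c = 0}"
  have "\<psi> 0 = 0" using add[of 0 0] is_subringD[OF is_subring_C_set] by simp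
  then have "ideal ?I (ring_on (C_set s n r d))"
    using is_subringD[OF is_subring_C_set]
    by (intro ideal_ring_onI is_subring_C_set) (auto simp: add mult)
  moreover have "f_poly s n d ` {1..r} \<subseteq> ?I"
    using f by (auto intro!: f_poly_in_C_set)
  ultimately have "f_ideal s n r d \<subseteq> ?I"
    unfolding f_ideal_def genideal_def C_ring_def by blast
  with c show ?thesis by auto
qed

section \<open>Inertia forms as a saturation\<close>

text \<open>The image of \<open>c\<close> in the product of the \<open>B\<^sub>\<sigma>\<close> vanishes when in each factor a power of \<open>\<sigma>\<close> kills
  the class of \<open>c\<close> in \<open>B\<close>.\<close>

lemma inertia_forms_iff:
  fixes c :: "'k::idom C_poly"
  shows "c \<in> inertia_forms s n r d \<longleftrightarrow> c \<in> C_set s n r d \<and>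
    (\<forall>\<iota>\<in>sigma_idx s n. \<exists>k. sigma_poly s \<iota> ^ k * c \<in> f_ideal s n r d)"
proof (cases "c \<in> C_set s n r d")
  case False
  then show ?thesis by (simp add: inertia_forms_def C_ring_def)
next
  case True
  let ?C = "C_ring s n r d :: 'k C_poly ring" and ?I = "f_ideal s n r d :: 'k C_poly set"
    and ?B = "B_ring s n r d :: 'k C_poly set ring" and ?p = "p_map s n r d :: 'k C_poly \<Rightarrow> 'k C_poly set"
  interpret C: cring ?C
    unfolding C_ring_def by (rule cring_ring_on[OF is_subring_C_set])
  interpret I: ideal ?I ?C by (rule ideal_f_ideal)
  interpret B: cring ?B
    unfolding B_ring_def by (rule I.quotient_is_cring) (rule C.cring_axioms)
  have hom: "?p \<in> ring_hom ?C ?B"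
    unfolding B_ring_def p_map_def by (rule I.rcos_ring_hom)
  interpret p: ring_hom_cring ?C ?B ?p
    by (intro ring_hom_cring.intro ring_hom_cring_axioms.intro hom C.cring_axioms B.cring_axioms)
  have car: "x \<in> carrier ?C \<longleftrightarrow> x \<in> C_set s n r d" for x by (simp add: C_ring_def)
  have zero_iff: "?p x = \<zero>\<^bsub>?B\<^esub> \<longleftrightarrow> x \<in> ?I" if "x \<in> C_set s n r d" for x
  proof
    assume "?p x = \<zero>\<^bsub>?B\<^esub>"
    then have "?I +>\<^bsub>?C\<^esub> x = ?I" by (simp add: p_map_def B_ring_def FactRing_def)
    then show "x \<in> ?I" using I.a_rcos_self[of x] that car by auto
  next
    assume "x \<in> ?I"
    then show "?p x = \<zero>\<^bsub>?B\<^esub>" using I.a_rcos_const by (simp add: p_map_def B_ring_def FactRing_def)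
  qed
  have sig: "(\<exists>u\<in>powers ?B (?p (sigma_poly s \<iota>)). u \<otimes>\<^bsub>?B\<^esub> ?p c = \<zero>\<^bsub>?B\<^esub>) \<longleftrightarrow>
      (\<exists>k. sigma_poly s \<iota> ^ k * c \<in> ?I)"
    and clo: "to_localization_at ?B (?p (sigma_poly s \<iota>)) (?p c) = \<zero>\<^bsub>B_sigma s n r d \<iota>\<^esub> \<longleftrightarrow>
      (\<exists>u\<in>powers ?B (?p (sigma_poly s \<iota>)). u \<otimes>\<^bsub>?B\<^esub> ?p c = \<zero>\<^bsub>?B\<^esub>)"
    if \<iota>: "\<iota> \<in> sigma_idx s n" for \<iota>
  proof -
    have \<sigma>: "sigma_poly s \<iota> ^ k \<in> (C_set s n r d :: 'k C_poly set)" for k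
      using sigma_power_in_eps_free[OF \<iota>] eps_free_subset by blast
    have pc: "?p c \<in> carrier ?B" and p\<sigma>: "?p (sigma_poly s \<iota>) \<in> carrier ?B"
      using True \<sigma>[of 1] car by simp_all
    have "?p (sigma_poly s \<iota>) [^]\<^bsub>?B\<^esub> k \<otimes>\<^bsub>?B\<^esub> ?p c = ?p (sigma_poly s \<iota> ^ k * c)" for k :: nat
    proof -
      have "?p (sigma_poly s \<iota>) [^]\<^bsub>?B\<^esub> k = ?p (sigma_poly s \<iota> [^]\<^bsub>?C\<^esub> k)"
        using \<sigma>[of 1] car by (simp add: p.ring.hom_nat_pow)
      also have "\<dots> = ?p (sigma_poly s \<iota> ^ k)" by (simp add: C_ring_def nat_pow_ring_on)
      finally show ?thesis
        using \<sigma>[of k] True car p.hom_mult[of "sigma_poly s \<iota> ^ k" c] by (simp add: C_ring_def)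
    qed
    then have *: "?p (sigma_poly s \<iota>) [^]\<^bsub>?B\<^esub> k \<otimes>\<^bsub>?B\<^esub> ?p c = \<zero>\<^bsub>?B\<^esub> \<longleftrightarrow> sigma_poly s \<iota> ^ k * c \<in> ?I"
      for k :: nat
      using zero_iff is_subringD(4)[OF is_subring_C_set \<sigma> True] by simp
    show "(\<exists>u\<in>powers ?B (?p (sigma_poly s \<iota>)). u \<otimes>\<^bsub>?B\<^esub> ?p c = \<zero>\<^bsub>?B\<^esub>) \<longleftrightarrow>
        (\<exists>k. sigma_poly s \<iota> ^ k * c \<in> ?I)"
      unfolding *[symmetric] by (rule bex_powers[where P = "\<lambda>u. u \<otimes>\<^bsub>?B\<^esub> ?p c = \<zero>\<^bsub>?B\<^esub>"])
    show "to_localization_at ?B (?p (sigma_poly s \<iota>)) (?p c) = \<zero>\<^bsub>B_sigma s n r d \<iota>\<^esub> \<longleftrightarrow>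
      (\<exists>u\<in>powers ?B (?p (sigma_poly s \<iota>)). u \<otimes>\<^bsub>?B\<^esub> ?p c = \<zero>\<^bsub>?B\<^esub>)"
      unfolding to_localization_at_def B_sigma_def localization_at_def
      unfolding zero_localization
      by (rule loc_frac_eq_zero_iff[OF B.cring_axioms powers_submonoid[OF B.cring_axioms p\<sigma>] pc])
  qed
  have "c \<in> carrier ?C" "?p c \<in> carrier ?B" using True car by simp_all
  then have "c \<in> inertia_forms s n r d \<longleftrightarrow>
      pi_map s n r d (?p c) = \<zero>\<^bsub>product_ring (sigma_idx s n) (B_sigma s n r d)\<^esub>"
    unfolding inertia_forms_def a_kernel_def' mem_Collect_eq by iprover
  also have "\<dots> \<longleftrightarrow> (\<forall>\<iota>\<in>sigma_idx s n.
      to_localization_at ?B (?p (sigma_poly s \<iota>)) (?p c) = \<zero>\<^bsub>B_sigma s n r d \<iota>\<^esub>)"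
    unfolding pi_map_def zero_product_ring by (rule restrict_eq_iff)
  finally show ?thesis using True sig clo by simp
qed

end

section \<open>Eliminating the distinguished coefficients\<close>

context
  fixes s r :: nat and n :: "nat \<Rightarrow> nat" and d :: "nat \<Rightarrow> nat \<Rightarrow> nat"
begin

lemma pconst_in_C_set: "c \<in> A_set s n r d \<Longrightarrow> pconst c \<in> C_set s n r d"
  unfolding C_set_def by (intro polys_pconst is_subringD[OF is_subring_A_set]) auto

text \<open>The ring \<open>C\<close> is generated by \<open>K\<close> and all the indeterminates; the \<open>\<epsilon>\<^sub>i\<close> of the chart \<open>\<iota>\<close> form a
  case of their own.\<close>

lemma C_set_ring_induct [consumes 1, case_names const eps U var add mult]:
  fixes c :: "'k::idom C_poly"
  assumes c: "c \<in> C_set s n r d"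
    and const: "\<And>a. Q (pconst (pconst a))"
    and eps: "\<And>i. i \<in> {1..r} \<Longrightarrow> Q (pconst (pvar (i, vexp s \<iota> (d i))))"
    and U: "\<And>u. u \<in> U_idx s n r d - (\<lambda>i. (i, vexp s \<iota> (d i))) ` {1..r} \<Longrightarrow> Q (pconst (pvar u))"
    and var: "\<And>v. v \<in> X_idx s n \<Longrightarrow> Q (pvar v)"
    and add: "\<And>x y. Q x \<Longrightarrow> Q y \<Longrightarrow> Q (x + y)"
    and mult: "\<And>x y. Q x \<Longrightarrow> Q y \<Longrightarrow> Q (x * y)"
  shows "Q c"
  using c is_subring_A_set unfolding C_set_def
proof (induction rule: polys_ring_induct)
  case (const a)
  then show ?case using is_subring_UNIV unfolding A_set_def
  proof (induction rule: polys_ring_induct)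
    case (var u)
    then show ?case using eps U by (cases "u \<in> (\<lambda>i. (i, vexp s \<iota> (d i))) ` {1..r}") auto
  qed (auto simp: pconst_add pconst_mult intro: assms)
qed (auto intro: assms)

text \<open>Modulo \<open>f\<^sub>i = \<epsilon>\<^sub>i \<tau>\<^sub>i + g\<^sub>i\<close> one has \<open>\<tau>\<^sub>i \<epsilon>\<^sub>i = - g\<^sub>i\<close>, and \<open>\<tau>\<^sub>i\<close> divides a power of \<open>\<sigma>\<close>.  So a power of
  \<open>\<sigma>\<close> brings \<open>\<epsilon>\<^sub>i\<close> into \<open>A'[X]\<close>, and the elements with this property form a ring.\<close>

lemma pseudo_division:
  fixes c :: "'k::idom C_poly"
  assumes \<iota>: "\<iota> \<in> sigma_idx s n" and "c \<in> C_set s n r d"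
  shows "\<exists>N. \<exists>a\<in>eps_free s r n d \<iota>. sigma_poly s \<iota> ^ N * c - a \<in> f_ideal s n r d"
proof -
  let ?E = "eps_free s r n d \<iota> :: 'k C_poly set" and ?I = "f_ideal s n r d :: 'k C_poly set"
    and ?\<sigma> = "sigma_poly s \<iota> :: 'k C_poly"
  define Q where "Q c \<longleftrightarrow> (\<exists>N. \<exists>a\<in>?E. ?\<sigma> ^ N * c - a \<in> ?I)" for c
  note E = is_subringD[OF is_subring_eps_free[of s r n d \<iota>, where ?'a = 'k]]
  have EC: "x \<in> C_set s n r d" if "x \<in> ?E" for x using that eps_free_subset by blast
  have \<sigma>: "?\<sigma> ^ k \<in> ?E" for k by (rule sigma_power_in_eps_free[OF \<iota>])
  have free: "Q x" if "x \<in> ?E" for x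
    unfolding Q_def using that by (intro exI[of _ 0] bexI[of _ x]) (simp_all add: f_idealD(2))
  have "Q c"
    using assms(2)
  proof (induction rule: C_set_ring_induct[where \<iota> = \<iota>])
    case (const a)
    show ?case
      by (intro free[unfolded eps_free_def] polys_pconst is_subringD(2)[OF is_subring_polys] UNIV_I is_subring_UNIV)
  next
    case (eps i)
    obtain N e where e: "e \<in> ?E" "e * pmonom (vexp s \<iota> (d i)) = ?\<sigma> ^ N"
      using tau_dvd_sigma_power[OF \<iota>] by blast
    have "?\<sigma> ^ N * pconst (pvar (i, vexp s \<iota> (d i))) - (- (e * g_poly s n d \<iota> i)) = e * f_poly s n d i"
      unfolding e(2)[symmetric] f_poly_eq[OF \<iota>] by (simp add: algebra_simps)
    also have "\<dots> \<in> ?I" using e(1) eps by (intro f_idealD f_poly_in_f_ideal EC)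
    finally have "?\<sigma> ^ N * pconst (pvar (i, vexp s \<iota> (d i))) - (- (e * g_poly s n d \<iota> i)) \<in> ?I" .
    moreover have "- (e * g_poly s n d \<iota> i) \<in> ?E"
      by (intro E e(1) g_poly_in_eps_free[OF \<iota> eps])
    ultimately show ?case unfolding Q_def by blast
  next
    case (U u)
    then show ?case
      by (intro free[unfolded eps_free_def] polys_pconst polys_pvar is_subringD(2)[OF is_subring_polys] is_subring_UNIV)
  next
    case (var v)
    then show ?case by (intro free[unfolded eps_free_def] polys_pvar is_subring_polys is_subring_UNIV)
  next
    case (add x y)
    then obtain N a M b where x: "a \<in> ?E" "?\<sigma> ^ N * x - a \<in> ?I" and y: "b \<in> ?E" "?\<sigma> ^ M * y - b \<in> ?I"
      unfolding Q_def by blast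
    have "?\<sigma> ^ (N + M) * (x + y) - (?\<sigma> ^ M * a + ?\<sigma> ^ N * b) =
        ?\<sigma> ^ M * (?\<sigma> ^ N * x - a) + ?\<sigma> ^ N * (?\<sigma> ^ M * y - b)"
      by (simp add: algebra_simps power_add)
    also have "\<dots> \<in> ?I" by (intro f_idealD(3) f_idealD(5) x y EC \<sigma>)
    finally have "?\<sigma> ^ (N + M) * (x + y) - (?\<sigma> ^ M * a + ?\<sigma> ^ N * b) \<in> ?I" .
    moreover have "?\<sigma> ^ M * a + ?\<sigma> ^ N * b \<in> ?E" by (intro E(4) E(6) x y \<sigma>)
    ultimately show ?case unfolding Q_def by blast
  next
    case (mult x y)
    then obtain N a M b where x: "a \<in> ?E" "?\<sigma> ^ N * x - a \<in> ?I" and y: "b \<in> ?E" "?\<sigma> ^ M * y - b \<in> ?I"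
      unfolding Q_def by blast
    have "?\<sigma> ^ M * y = (?\<sigma> ^ M * y - b) + b" by simp
    then have "?\<sigma> ^ M * y \<in> C_set s n r d"
      using is_subringD(6)[OF is_subring_C_set, where x = "?\<sigma> ^ M * y - b" and y = b] subsetD[OF f_idealD(1) y(2)] EC[OF y(1)]
      by simp
    moreover have "?\<sigma> ^ (N + M) * (x * y) - a * b =
        ?\<sigma> ^ M * y * (?\<sigma> ^ N * x - a) + a * (?\<sigma> ^ M * y - b)"
      by (simp add: algebra_simps power_add)
    ultimately have "?\<sigma> ^ (N + M) * (x * y) - a * b \<in> ?I"
      using x(2) y(2) EC[OF x(1)] by (simp add: f_idealD(3) f_idealD(5))
    moreover have "a * b \<in> ?E" by (intro E(4) x y)
    ultimately show ?case unfolding Q_def by blast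
  qed
  then show ?thesis by (simp add: Q_def)
qed

text \<open>The homomorphism with \<open>\<epsilon>\<^sub>i \<mapsto> t\<^sub>i - g\<^sub>i / \<tau>\<^sub>i\<close> that agrees with the embedding \<open>h\<close> on all other
  indeterminates.  It is made so that \<open>f\<^sub>i \<mapsto> \<tau>\<^sub>i t\<^sub>i\<close> while \<open>A'[X]\<close> stays fixed.  With \<open>t = 0\<close> it kills the
  ideal of the \<open>f\<^sub>i\<close>; with \<open>t\<^sub>i = T\<^sub>i\<close> it turns the fractions \<open>f\<^sub>i / \<tau>\<^sub>i\<close> into indeterminates.\<close>

definition eps_subst_U ::
  "('k::idom C_poly \<Rightarrow> 'b::field) \<Rightarrow> (nat \<Rightarrow> nat) \<Rightarrow> (nat \<Rightarrow> 'b) \<Rightarrow> nat \<times> mexp \<Rightarrow> 'b" where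
  "eps_subst_U h \<iota> t u = (if snd u = vexp s \<iota> (d (fst u))
     then t (fst u) - h (g_poly s n d \<iota> (fst u)) / h (pmonom (snd u)) else h (pconst (pvar u)))"

definition eps_subst ::
  "('k::idom C_poly \<Rightarrow> 'b::field) \<Rightarrow> (nat \<Rightarrow> nat) \<Rightarrow> (nat \<Rightarrow> 'b) \<Rightarrow> 'k C_poly \<Rightarrow> 'b" where
  "eps_subst h \<iota> t = peval (peval (\<lambda>c. h (pconst (pconst c))) (eps_subst_U h \<iota> t)) (\<lambda>v. h (pvar v))"

context
  fixes h :: "'k::idom C_poly \<Rightarrow> 'b::field" and \<iota> :: "nat \<Rightarrow> nat" and t :: "nat \<Rightarrow> 'b"
  assumes \<iota>: "\<iota> \<in> sigma_idx s n" and h: "is_ring_map h" "\<And>x. h x = 0 \<longleftrightarrow> x = 0"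
begin

lemma is_ring_map_eps_subst: "is_ring_map (eps_subst h \<iota> t)"
  unfolding eps_subst_def
  by (intro is_ring_map_peval is_ring_map_comp[OF h(1)] is_ring_map_comp[of pconst pconst] is_ring_map_pconst)

lemma eps_subst_simps:
  "eps_subst h \<iota> t (pconst (pconst c)) = h (pconst (pconst c))"
  "eps_subst h \<iota> t (pconst (pvar u)) = eps_subst_U h \<iota> t u"
  "eps_subst h \<iota> t (pvar v) = h (pvar v)"
proof -
  have 1: "is_ring_map (\<lambda>c. h (pconst (pconst c)))"
    by (intro is_ring_map_comp[OF h(1)] is_ring_map_comp[of pconst pconst] is_ring_map_pconst)
  have 2: "is_ring_map (peval (\<lambda>c. h (pconst (pconst c))) (eps_subst_U h \<iota> t))"
    by (rule is_ring_map_peval[OF 1])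
  show "eps_subst h \<iota> t (pconst (pconst c)) = h (pconst (pconst c))"
    "eps_subst h \<iota> t (pconst (pvar u)) = eps_subst_U h \<iota> t u" "eps_subst h \<iota> t (pvar v) = h (pvar v)"
    by (simp_all add: eps_subst_def peval_pconst[OF 1] peval_pconst[OF 2] peval_pvar[OF 1] peval_pvar[OF 2])
qed

lemma eps_subst_eps_free:
  assumes "c \<in> eps_free s r n d \<iota>"
  shows "eps_subst h \<iota> t c = h c"
proof -
  let ?V = "U_idx s n r d - (\<lambda>i. (i, vexp s \<iota> (d i))) ` {1..r}"
  have coeff: "eps_subst h \<iota> t (pconst a) = h (pconst a)" if "a \<in> polys UNIV ?V" for a
  proof (rule ring_map_polys_eqI[OF that is_subring_UNIV,
      where \<phi> = "\<lambda>a. eps_subst h \<iota> t (pconst a)" and \<psi> = "\<lambda>a. h (pconst a)"])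
    show "is_ring_map (\<lambda>a. eps_subst h \<iota> t (pconst a))"
      by (rule is_ring_map_comp[OF is_ring_map_eps_subst is_ring_map_pconst])
    show "is_ring_map (\<lambda>a. h (pconst a))"
      by (rule is_ring_map_comp[OF h(1) is_ring_map_pconst])
    show "eps_subst h \<iota> t (pconst (pvar u)) = h (pconst (pvar u))" if "u \<in> ?V" for u
    proof -
      have "snd u \<noteq> vexp s \<iota> (d (fst u))" using that by (cases u) (auto simp: U_idx_def)
      then show ?thesis by (simp only: eps_subst_simps eps_subst_U_def if_False)
    qed
  qed (rule eps_subst_simps)
  show ?thesis
    by (rule ring_map_polys_eqI[OF assms[unfolded eps_free_def] is_subring_polys[OF is_subring_UNIV],
        where \<phi> = "eps_subst h \<iota> t" and \<psi> = h, OF is_ring_map_eps_subst h(1) coeff eps_subst_simps(3)])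
qed

lemma eps_subst_f_poly:
  assumes "i \<in> {1..r}"
  shows "eps_subst h \<iota> t (f_poly s n d i) = h (pmonom (vexp s \<iota> (d i))) * t i"
proof -
  have "eps_subst h \<iota> t (f_poly s n d i) =
      eps_subst_U h \<iota> t (i, vexp s \<iota> (d i)) * h (pmonom (vexp s \<iota> (d i))) + h (g_poly s n d \<iota> i)"
    using eps_subst_eps_free[OF pmonom_vexp_in_eps_free[OF \<iota>]]
      eps_subst_eps_free[OF g_poly_in_eps_free[OF \<iota> assms]]
    by (simp add: f_poly_eq[OF \<iota>] is_ring_mapD[OF is_ring_map_eps_subst] eps_subst_simps)
  also have "\<dots> = h (pmonom (vexp s \<iota> (d i))) * t i"
    by (simp add: eps_subst_U_def h field_simps)
  finally show ?thesis .
qed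

end

text \<open>The substitution with \<open>t = 0\<close> kills \<open>(f\<^sub>1, \<dots>, f\<^sub>r)\<close> and embeds \<open>A'[X]\<close> into a field.  The factor \<open>b\<close>
  is going to be a power of the \<open>\<sigma>\<close> of a second chart.\<close>

lemma eps_free_eq_0_if_mult_in_f_ideal:
  assumes \<iota>: "\<iota> \<in> sigma_idx s n" and "b \<in> eps_free s r n d \<iota>" "b \<noteq> 0"
    and "a \<in> eps_free s r n d \<iota>" "b * a \<in> f_ideal s n r d"
  shows "a = 0"
proof -
  note prem = \<iota> is_ring_map_to_fract to_fract_eq_0_iff
  note hom = is_ring_mapD[OF is_ring_map_eps_subst[OF prem]]
  have "eps_subst to_fract \<iota> (\<lambda>_. 0) (b * a) = 0"
    using assms(5) by (rule f_ideal_in_kernel[rotated 3]) (simp_all add: hom eps_subst_f_poly[OF prem])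
  then have "to_fract b * to_fract a = 0"
    unfolding hom using eps_subst_eps_free[OF prem assms(2)] eps_subst_eps_free[OF prem assms(4)] by simp
  with \<open>b \<noteq> 0\<close> show ?thesis by simp
qed

text \<open>All charts give the same saturation.  Let \<open>\<sigma>\<^sub>\<kappa>\<^sup>N c \<equiv> a\<close> modulo \<open>(f)\<close>, with \<open>a\<close> free of the
  \<open>\<epsilon>\<^sub>i\<close> of the chart \<open>\<kappa>\<close>.  If a power of \<open>\<sigma>\<^sub>\<iota>\<close> brings \<open>c\<close> into the ideal, then it also brings \<open>a\<close> there; that power is a
  monomial in the \<open>X\<close> alone, so the preceding lemma gives \<open>a = 0\<close>.\<close>

lemma saturation_independent:
  fixes c :: "'k::idom C_poly"
  assumes \<iota>: "\<iota> \<in> sigma_idx s n" and \<kappa>: "\<kappa> \<in> sigma_idx s n" and c: "c \<in> C_set s n r d"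
    and k: "sigma_poly s \<iota> ^ k * c \<in> f_ideal s n r d"
  shows "\<exists>l. sigma_poly s \<kappa> ^ l * c \<in> f_ideal s n r d"
proof -
  let ?I = "f_ideal s n r d :: 'k C_poly set"
    and ?\<sigma> = "sigma_poly s \<iota> ^ k :: 'k C_poly" and ?\<kappa> = "sigma_poly s \<kappa> :: 'k C_poly"
  obtain N a where a: "a \<in> eps_free s r n d \<kappa>" "?\<kappa> ^ N * c - a \<in> ?I"
    using pseudo_division[OF \<kappa> c] by blast
  have \<sigma>: "?\<sigma> \<in> eps_free s r n d \<kappa>"
    unfolding sigma_poly_power eps_free_def
    by (intro polys_pmonom keys_vexp[OF \<iota>] is_subringD[OF is_subring_polys[OF is_subring_UNIV]])
  have "?\<sigma> * a = ?\<kappa> ^ N * (?\<sigma> * c) - ?\<sigma> * (?\<kappa> ^ N * c - a)"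
    by (simp add: algebra_simps)
  also have "\<dots> \<in> ?I"
    by (intro f_idealD(4) f_idealD(5) k a(2) subsetD[OF eps_free_subset \<sigma>]
        subsetD[OF eps_free_subset sigma_power_in_eps_free[OF \<kappa>]])
  finally have "a = 0"
    by (rule eps_free_eq_0_if_mult_in_f_ideal[OF \<kappa> \<sigma> sigma_poly_neq_0 a(1)])
  with a(2) have "?\<kappa> ^ N * c \<in> ?I" by simp
  then show ?thesis ..
qed

lemma inertia_forms_iff_sigma_q:
  fixes c :: "'k::idom C_poly"
  shows "c \<in> inertia_forms s n r d \<longleftrightarrow> c \<in> C_set s n r d \<and> (\<exists>k. sigma_q s n ^ k * c \<in> f_ideal s n r d)"
  unfolding inertia_forms_iff sigma_q_eq
  using saturation_independent[OF last_in_sigma_idx] last_in_sigma_idx by blast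

end

section \<open>The kernel of the map to the fractions\<close>

context
  fixes s r :: nat and n :: "nat \<Rightarrow> nat" and d :: "nat \<Rightarrow> nat \<Rightarrow> nat"
begin

abbreviation "last_idx \<equiv> (\<lambda>j\<in>{1..s}. n j + 1)"
abbreviation "CT_set \<equiv> polys (C_set s n r d) {1..r}"
abbreviation "eps_free_CT \<equiv> polys (eps_free s r n d last_idx) {1..r}"

lemma is_subring_CT_set: "is_subring CT_set"
  by (rule is_subring_polys[OF is_subring_C_set])

lemma pconst_in_CT_set: "c \<in> C_set s n r d \<Longrightarrow> pconst c \<in> CT_set"
  by (rule polys_pconst) (auto intro: is_subringD(2)[OF is_subring_C_set])

lemma sigma_q_power_in_eps_free: "sigma_q s n ^ k \<in> eps_free s r n d last_idx"
  unfolding sigma_q_eq by (rule sigma_power_in_eps_free[OF last_in_sigma_idx])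

lemma sigma_q_power_in_C_set: "sigma_q s n ^ k \<in> C_set s n r d"
  using sigma_q_power_in_eps_free by (rule subsetD[OF eps_free_subset])

lemma sigma_q_power_neq_0: "sigma_q s n ^ k \<noteq> 0"
  unfolding sigma_q_eq by (rule sigma_poly_neq_0)

lemma tau_poly_eq: "tau_poly s n d i = pmonom (vexp s last_idx (d i))"
  by (simp add: tau_poly_eq_pmonom tau_exp_eq)

lemma tau_poly_in_eps_free: "tau_poly s n d i \<in> eps_free s r n d last_idx"
  unfolding tau_poly_eq by (rule pmonom_vexp_in_eps_free[OF last_in_sigma_idx])

lemma A'XT_set_eq: "A'XT_set s n r d = eps_free_CT"
  by (simp add: A'XT_set_def A'_set_def eps_free_def tau_exp_eq)

text \<open>Division of all coefficients at once, by a common power of \<open>\<sigma>\<^sub>q\<close>.\<close>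

lemma pseudo_division_CT:
  fixes P :: "'k::idom CT_poly"
  assumes "P \<in> CT_set"
  shows "\<exists>N. \<exists>Q\<in>eps_free_CT. pconst (sigma_q s n ^ N) * P - Q \<in> polys (f_ideal s n r d) {1..r}"
  using assms
proof (induction rule: polys_sum_induct)
  case zero
  show ?case
    by (intro exI[of _ 0] bexI[of _ 0])
       (simp_all add: polys_def f_idealD(2) is_subringD(2)[OF is_subring_eps_free])
next
  case (monomial c m)
  obtain N a where a: "a \<in> eps_free s r n d last_idx" "sigma_q s n ^ N * c - a \<in> f_ideal s n r d"
    using pseudo_division[OF last_in_sigma_idx monomial(1)] unfolding sigma_q_eq by blast
  have "pconst (sigma_q s n ^ N) * (pconst c * pmonom m) - pconst a * pmonom m =
      pconst (sigma_q s n ^ N * c - a) * pmonom m"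
    by (simp add: pconst_diff pconst_mult algebra_simps)
  also have "\<dots> \<in> polys (f_ideal s n r d) {1..r}"
    by (intro polys_monomial a(2) f_idealD(2) monomial(2))
  finally show ?case
    using polys_monomial[OF a(1) is_subringD(2)[OF is_subring_eps_free] monomial(2)] by blast
next
  case (add x y)
  let ?\<sigma> = "sigma_q s n :: 'k C_poly" and ?J = "polys (f_ideal s n r d) {1..r} :: 'k CT_poly set"
  from add obtain N Q M R where x: "Q \<in> eps_free_CT" "pconst (?\<sigma> ^ N) * x - Q \<in> ?J"
    and y: "R \<in> eps_free_CT" "pconst (?\<sigma> ^ M) * y - R \<in> ?J" by blast
  have J: "pconst (?\<sigma> ^ k) * p \<in> ?J" if "p \<in> ?J" for p k
    by (rule polys_pconst_mult[OF that]) (rule f_idealD(5)[OF sigma_q_power_in_C_set])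
  have E: "pconst (?\<sigma> ^ k) * p \<in> eps_free_CT" if "p \<in> eps_free_CT" for p k
    by (rule polys_pconst_mult[OF that])
       (rule is_subringD(4)[OF is_subring_eps_free sigma_q_power_in_eps_free])
  have "pconst (?\<sigma> ^ (N + M)) * (x + y) - (pconst (?\<sigma> ^ M) * Q + pconst (?\<sigma> ^ N) * R) =
      pconst (?\<sigma> ^ M) * (pconst (?\<sigma> ^ N) * x - Q) + pconst (?\<sigma> ^ N) * (pconst (?\<sigma> ^ M) * y - R)"
    by (simp add: power_add pconst_mult algebra_simps)
  also have "\<dots> \<in> ?J" by (intro polys_add J x y f_idealD(3))
  finally have "pconst (?\<sigma> ^ (N + M)) * (x + y) - (pconst (?\<sigma> ^ M) * Q + pconst (?\<sigma> ^ N) * R) \<in> ?J" .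
  moreover have "pconst (?\<sigma> ^ M) * Q + pconst (?\<sigma> ^ N) * R \<in> eps_free_CT"
    by (intro polys_add E x y is_subringD(6)[OF is_subring_eps_free])
  ultimately show ?case by blast
qed

text \<open>Here \<open>\<Phi>\<close> is \<open>F\<close> followed by the embedding of \<open>C\<^bsub>\<sigma>\<^sub>q\<^esub>\<close> into the fraction field of \<open>C\<close>; names with
  \<open>FG\<close> are about \<open>\<Phi> \<circ> G\<close>.\<close>

context
  fixes \<Phi> :: "'k::idom CT_poly \<Rightarrow> 'k C_poly fract"
  assumes \<Phi>_add: "\<And>x y. x \<in> CT_set \<Longrightarrow> y \<in> CT_set \<Longrightarrow> \<Phi> (x + y) = \<Phi> x + \<Phi> y"
    and \<Phi>_mult: "\<And>x y. x \<in> CT_set \<Longrightarrow> y \<in> CT_set \<Longrightarrow> \<Phi> (x * y) = \<Phi> x * \<Phi> y"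
    and \<Phi>_const: "\<And>c. c \<in> C_set s n r d \<Longrightarrow> \<Phi> (pconst c) = to_fract c"
    and \<Phi>_var: "\<And>i. i \<in> {1..r} \<Longrightarrow> \<Phi> (pvar i) = to_fract (f_poly s n d i) / to_fract (tau_poly s n d i)"
begin

text \<open>The fractions \<open>f\<^sub>i / \<tau>\<^sub>i = \<epsilon>\<^sub>i + g\<^sub>i / \<tau>\<^sub>i\<close> are algebraically independent over \<open>A'[X]\<close>.  To see it, let
  \<open>\<chi>\<close> be the substitution with \<open>t\<^sub>i = T\<^sub>i\<close>, which sends \<open>f\<^sub>i / \<tau>\<^sub>i\<close> to \<open>T\<^sub>i\<close>, and let \<open>\<chi>'\<close> be its extension to
  \<open>C[T]\<close> that fixes the \<open>T\<^sub>i\<close>.  Then \<open>\<chi> \<circ> \<Phi> = \<chi>'\<close> up to denominators, and \<open>\<chi>'\<close> fixes \<open>A'[X][T]\<close>.  As \<open>\<chi>\<close> is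
  defined on \<open>C\<close> and not on fractions, a power of \<open>\<sigma>\<^sub>q\<close> first clears the denominator of \<open>\<Phi> P\<close>.\<close>

lemma eps_free_CT_kernel_trivial:
  assumes Q: "Q \<in> eps_free_CT" and "\<Phi> Q = 0"
  shows "Q = 0"
proof -
  define h :: "'k C_poly \<Rightarrow> 'k CT_poly fract" where "h = (\<lambda>c. to_fract (pconst c))"
  define t :: "nat \<Rightarrow> 'k CT_poly fract" where "t = (\<lambda>i. to_fract (pvar i))"
  let ?\<sigma> = "sigma_q s n :: 'k C_poly"
  let ?\<chi> = "eps_subst s n d h last_idx t"
  let ?\<chi>' = "peval ?\<chi> t"
  have h: "is_ring_map h" "h x = 0 \<longleftrightarrow> x = 0" for x
    unfolding h_def by (rule is_ring_map_comp[OF is_ring_map_to_fract is_ring_map_pconst]) simp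
  note prem = last_in_sigma_idx[where s = s and n = n] h
  have \<chi>: "is_ring_map ?\<chi>" by (rule is_ring_map_eps_subst[OF prem])
  have \<chi>': "is_ring_map ?\<chi>'" by (rule is_ring_map_peval[OF \<chi>])
  have \<chi>_free: "?\<chi> a = h a" if "a \<in> eps_free s r n d last_idx" for a
    by (rule eps_subst_eps_free[OF prem that])
  note \<chi>_\<sigma> = \<chi>_free[OF sigma_q_power_in_eps_free]
  have "\<exists>N c. \<Phi> P * to_fract (?\<sigma> ^ N) = to_fract c \<and> ?\<chi> c = h (?\<sigma> ^ N) * ?\<chi>' P" if "P \<in> CT_set" for P
  proof -
    define R where "R P \<longleftrightarrow> P \<in> CT_set \<and>
      (\<exists>N c. \<Phi> P * to_fract (?\<sigma> ^ N) = to_fract c \<and> ?\<chi> c = h (?\<sigma> ^ N) * ?\<chi>' P)" for P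
    have "R P"
      using that is_subring_C_set
    proof (induction rule: polys_ring_induct)
      case (const c)
      have "?\<chi> c = h (?\<sigma> ^ 0) * ?\<chi>' (pconst c)"
        by (simp only: power_0 peval_pconst[OF \<chi>] is_ring_mapD(1)[OF h(1)] mult_1_left)
      moreover have "\<Phi> (pconst c) * to_fract (?\<sigma> ^ 0) = to_fract c"
        by (simp add: \<Phi>_const const)
      ultimately show ?case unfolding R_def using pconst_in_CT_set[OF const] by blast
    next
      case (var i)
      obtain N e where e: "e \<in> eps_free s r n d last_idx"
        "e * tau_poly s n d i = ?\<sigma> ^ N"
        using tau_dvd_sigma_power[OF last_in_sigma_idx] unfolding sigma_q_eq tau_poly_eq by blast
      have "to_fract (tau_poly s n d i :: 'k C_poly) \<noteq> 0" by (simp add: tau_poly_eq)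
      then have "\<Phi> (pvar i) * to_fract (?\<sigma> ^ N) = to_fract (e * f_poly s n d i)"
        unfolding e(2)[symmetric] by (simp add: \<Phi>_var[OF var] field_simps)
      moreover have "?\<chi> (e * f_poly s n d i) = h e * (h (tau_poly s n d i) * t i)"
        unfolding is_ring_mapD(4)[OF \<chi>] \<chi>_free[OF e(1)] eps_subst_f_poly[OF prem var] tau_poly_eq ..
      then have "?\<chi> (e * f_poly s n d i) = h (?\<sigma> ^ N) * ?\<chi>' (pvar i)"
        unfolding e(2)[symmetric] peval_pvar[OF \<chi>] is_ring_mapD(4)[OF h(1)] mult.assoc .
      ultimately show ?case unfolding R_def using polys_pvar[OF is_subring_C_set var] by blast
    next
      case (add x y)
      then obtain N c M e where x: "x \<in> CT_set" "\<Phi> x * to_fract (?\<sigma> ^ N) = to_fract c" "?\<chi> c = h (?\<sigma> ^ N) * ?\<chi>' x"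
        and y: "y \<in> CT_set" "\<Phi> y * to_fract (?\<sigma> ^ M) = to_fract e" "?\<chi> e = h (?\<sigma> ^ M) * ?\<chi>' y"
        unfolding R_def by blast
      have "\<Phi> (x + y) * to_fract (?\<sigma> ^ (N + M)) = to_fract (?\<sigma> ^ M * c + ?\<sigma> ^ N * e)"
        unfolding \<Phi>_add[OF x(1) y(1)] power_add to_fract_add to_fract_mult x(2)[symmetric] y(2)[symmetric]
        by (simp add: algebra_simps)
      moreover have "?\<chi> (?\<sigma> ^ M * c + ?\<sigma> ^ N * e) = h (?\<sigma> ^ (N + M)) * ?\<chi>' (x + y)"
        unfolding is_ring_mapD(3,4)[OF \<chi>] is_ring_mapD(3)[OF \<chi>'] \<chi>_\<sigma> x(3) y(3) power_add
          is_ring_mapD(4)[OF h(1)] by (simp add: algebra_simps)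
      moreover have "x + y \<in> CT_set" by (rule is_subringD(6)[OF is_subring_CT_set x(1) y(1)])
      ultimately show ?case unfolding R_def by blast
    next
      case (mult x y)
      then obtain N c M e where x: "x \<in> CT_set" "\<Phi> x * to_fract (?\<sigma> ^ N) = to_fract c" "?\<chi> c = h (?\<sigma> ^ N) * ?\<chi>' x"
        and y: "y \<in> CT_set" "\<Phi> y * to_fract (?\<sigma> ^ M) = to_fract e" "?\<chi> e = h (?\<sigma> ^ M) * ?\<chi>' y"
        unfolding R_def by blast
      have "\<Phi> (x * y) * to_fract (?\<sigma> ^ (N + M)) = to_fract (c * e)"
        unfolding \<Phi>_mult[OF x(1) y(1)] power_add to_fract_mult x(2)[symmetric] y(2)[symmetric]
        by (simp add: algebra_simps)
      moreover have "?\<chi> (c * e) = h (?\<sigma> ^ (N + M)) * ?\<chi>' (x * y)"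
        unfolding is_ring_mapD(4)[OF \<chi>] is_ring_mapD(4)[OF \<chi>'] x(3) y(3) power_add
          is_ring_mapD(4)[OF h(1)] by (simp add: algebra_simps)
      moreover have "x * y \<in> CT_set" by (rule is_subringD(4)[OF is_subring_CT_set x(1) y(1)])
      ultimately show ?case unfolding R_def by blast
    qed
    then show ?thesis by (simp add: R_def)
  qed
  moreover have "Q \<in> CT_set" using Q by (rule subsetD[OF polys_mono[OF eps_free_subset subset_refl]])
  ultimately obtain N c where c: "\<Phi> Q * to_fract (?\<sigma> ^ N) = to_fract c" "?\<chi> c = h (?\<sigma> ^ N) * ?\<chi>' Q"
    by blast
  have "c = 0" using c(1) \<open>\<Phi> Q = 0\<close> by simp
  then have "h (?\<sigma> ^ N) * ?\<chi>' Q = 0" using c(2) is_ring_mapD(2)[OF \<chi>] by simp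
  then have "?\<chi>' Q = 0" unfolding mult_eq_0_iff h(2) using sigma_q_power_neq_0 by blast
  moreover have "?\<chi>' Q = to_fract Q"
  proof (rule ring_map_polys_eqI[OF Q is_subring_eps_free, where \<phi> = ?\<chi>' and \<psi> = to_fract, OF \<chi>' is_ring_map_to_fract])
    show "?\<chi>' (pconst a) = to_fract (pconst a)" if "a \<in> eps_free s r n d last_idx" for a
      using \<chi>_free[OF that] unfolding peval_pconst[OF \<chi>] by (simp only: h_def)
    show "?\<chi>' (pvar i) = to_fract (pvar i)" for i
      using peval_pvar[OF \<chi>, where x = t and v = i] by (simp only: t_def)
  qed
  ultimately show ?thesis by simp
qed

context
  fixes G :: "'k CT_poly \<Rightarrow> 'k CT_poly"
  assumes G_closed: "\<And>x. x \<in> CT_set \<Longrightarrow> G x \<in> CT_set"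
    and G_add: "\<And>x y. x \<in> CT_set \<Longrightarrow> y \<in> CT_set \<Longrightarrow> G (x + y) = G x + G y"
    and G_mult: "\<And>x y. x \<in> CT_set \<Longrightarrow> y \<in> CT_set \<Longrightarrow> G (x * y) = G x * G y"
    and G_free: "\<And>P. P \<in> eps_free_CT \<Longrightarrow> G P = P"
    and G_eps: "\<And>i. i \<in> {1..r} \<Longrightarrow> G (pconst (pconst (eps_poly s n d i)))
      = pconst (pconst (eps_poly s n d i)) - pvar i"
begin

lemma FG_add: "x \<in> CT_set \<Longrightarrow> y \<in> CT_set \<Longrightarrow> \<Phi> (G (x + y)) = \<Phi> (G x) + \<Phi> (G y)"
  by (simp only: G_add \<Phi>_add G_closed)

lemma FG_mult: "x \<in> CT_set \<Longrightarrow> y \<in> CT_set \<Longrightarrow> \<Phi> (G (x * y)) = \<Phi> (G x) * \<Phi> (G y)"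
  by (simp only: G_mult \<Phi>_mult G_closed)

lemma FG_pconst_eps_free:
  assumes "c \<in> eps_free s r n d last_idx"
  shows "\<Phi> (G (pconst c)) = to_fract c"
proof -
  have "pconst c \<in> eps_free_CT"
    by (rule polys_pconst[OF assms is_subringD(2)[OF is_subring_eps_free]])
  then show ?thesis using \<Phi>_const[OF subsetD[OF eps_free_subset assms]] by (simp only: G_free)
qed

text \<open>The automorphism is chosen for this: \<open>G f\<^sub>i = f\<^sub>i - T\<^sub>i \<tau>\<^sub>i\<close>, and \<open>F\<close> sends \<open>T\<^sub>i \<tau>\<^sub>i\<close> to \<open>f\<^sub>i\<close>.\<close>

lemma FG_f_poly_eq_0:
  assumes i: "i \<in> {1..r}"
  shows "\<Phi> (G (pconst (f_poly s n d i))) = 0"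
proof -
  let ?\<epsilon> = "pconst (pconst (eps_poly s n d i)) :: 'k CT_poly"
    and ?\<tau> = "pconst (tau_poly s n d i) :: 'k CT_poly" and ?g = "pconst (g_poly s n d last_idx i) :: 'k CT_poly"
    and ?f = "pconst (f_poly s n d i) :: 'k CT_poly"
  have f: "?f = ?\<epsilon> * ?\<tau> + ?g"
    by (simp add: f_poly_eq[OF last_in_sigma_idx] tau_poly_eq eps_poly_def tau_exp_eq pconst_add pconst_mult)
  have free: "?\<tau> \<in> eps_free_CT" "?g \<in> eps_free_CT"
    by (intro polys_pconst tau_poly_in_eps_free g_poly_in_eps_free[OF last_in_sigma_idx i]
        is_subringD(2)[OF is_subring_eps_free])+
  have free_sub: "eps_free_CT \<subseteq> CT_set" by (rule polys_mono[OF eps_free_subset subset_refl])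
  note CT = is_subringD[OF is_subring_CT_set]
  have \<tau>g: "?\<tau> \<in> CT_set" "?g \<in> CT_set" using free free_sub by blast+
  have "eps_poly s n d i \<in> A_set s n r d"
    unfolding A_set_def eps_poly_def using i tau_exp_in_mexps[of s n d i]
    by (intro polys_pvar) (auto simp: U_idx_def)
  then have \<epsilon>: "?\<epsilon> \<in> CT_set" by (intro pconst_in_CT_set pconst_in_C_set)
  have T: "pvar i \<in> CT_set" by (rule polys_pvar[OF is_subring_C_set i])
  have fC: "f_poly s n d i \<in> (C_set s n r d :: 'k C_poly set)" by (rule f_poly_in_C_set[OF i])
  have "G ?f = (?\<epsilon> - pvar i) * ?\<tau> + ?g"
    unfolding f G_add[OF CT(4)[OF \<epsilon> \<tau>g(1)] \<tau>g(2)] G_mult[OF \<epsilon> \<tau>g(1)] G_free[OF free(1)] G_free[OF free(2)] G_eps[OF i] ..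
  then have "?f = G ?f + pvar i * ?\<tau>" unfolding f by (simp add: algebra_simps)
  then have "\<Phi> ?f = \<Phi> (G ?f) + \<Phi> (pvar i) * \<Phi> ?\<tau>"
    using \<Phi>_add[OF G_closed[OF pconst_in_CT_set[OF fC]] CT(4)[OF T \<tau>g(1)]] \<Phi>_mult[OF T \<tau>g(1)] by simp
  moreover have "\<Phi> ?\<tau> = to_fract (tau_poly s n d i)"
    by (rule \<Phi>_const[OF subsetD[OF eps_free_subset tau_poly_in_eps_free]])
  moreover have "to_fract (tau_poly s n d i :: 'k C_poly) \<noteq> 0" by (simp add: tau_poly_eq)
  ultimately show ?thesis using \<Phi>_const[OF fC] \<Phi>_var[OF i] by simp
qed

text \<open>On \<open>C\<close> the composite \<open>F \<circ> G\<close> kills \<open>(f\<^sub>1, \<dots>, f\<^sub>r)\<close> and fixes \<open>\<sigma>\<^sub>q\<close>, which becomes invertible; hence it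
  kills the saturation of the ideal with respect to \<open>\<sigma>\<^sub>q\<close>.\<close>

lemma FG_eq_0_if_inertia:
  assumes "P \<in> polys (inertia_forms s n r d) {1..r}"
  shows "P \<in> CT_set \<and> \<Phi> (G P) = 0"
  using assms
proof (induction rule: polys_sum_induct)
  case zero
  have zero: "0 \<in> CT_set" by (rule is_subringD(2)[OF is_subring_CT_set])
  then have "\<Phi> (G 0) = 0" using FG_add[OF zero zero] by (metis add_0_right add_cancel_right_right)
  with zero show ?case ..
next
  case (add x y)
  then have x: "x \<in> CT_set" "\<Phi> (G x) = 0" and y: "y \<in> CT_set" "\<Phi> (G y) = 0" by blast+
  show ?case using is_subringD(6)[OF is_subring_CT_set x(1) y(1)] FG_add[OF x(1) y(1)] x(2) y(2) by simp
next
  case (monomial c m)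
  let ?\<sigma> = "sigma_q s n :: 'k C_poly"
  obtain k where c: "c \<in> C_set s n r d" and k: "?\<sigma> ^ k * c \<in> f_ideal s n r d"
    using monomial(1) unfolding inertia_forms_iff_sigma_q by blast
  have "\<Phi> (G (pconst (?\<sigma> ^ k * c))) = 0"
    using k by (rule f_ideal_in_kernel[rotated 3])
      (simp_all only: pconst_add pconst_mult FG_add FG_mult pconst_in_CT_set FG_f_poly_eq_0)
  then have "to_fract (?\<sigma> ^ k) * \<Phi> (G (pconst c)) = 0"
    unfolding pconst_mult FG_mult[OF pconst_in_CT_set[OF sigma_q_power_in_C_set] pconst_in_CT_set[OF c]]
      FG_pconst_eps_free[OF sigma_q_power_in_eps_free] .
  then have "\<Phi> (G (pconst c)) = 0" unfolding mult_eq_0_iff to_fract_eq_0_iff using sigma_q_power_neq_0 by blast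
  moreover have m: "pmonom m \<in> CT_set"
    using monomial(2) by (intro polys_pmonom is_subringD[OF is_subring_C_set])
  ultimately show ?case
    using FG_mult[OF pconst_in_CT_set[OF c] m] is_subringD(4)[OF is_subring_CT_set pconst_in_CT_set[OF c] m]
    by simp
qed

text \<open>Divide: \<open>\<sigma>\<^sub>q\<^sup>N P = Q + R\<close> with \<open>Q\<close> in \<open>A'[X][T]\<close> and the coefficients of \<open>R\<close> in \<open>(f\<^sub>1, \<dots>, f\<^sub>r)\<close>.  Since \<open>G\<close> fixes
  \<open>Q\<close> and \<open>F \<circ> G\<close> kills \<open>R\<close>, it follows that \<open>F Q = 0\<close>, so \<open>Q = 0\<close> and \<open>\<sigma>\<^sub>q\<^sup>N\<close> brings every coefficient of \<open>P\<close>
  into the ideal.\<close>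

lemma inertia_if_FG_eq_0:
  assumes P: "P \<in> CT_set" and "\<Phi> (G P) = 0"
  shows "P \<in> polys (inertia_forms s n r d) {1..r}"
proof -
  let ?\<sigma> = "sigma_q s n :: 'k C_poly" and ?J = "polys (f_ideal s n r d) {1..r} :: 'k CT_poly set"
  obtain N Q where Q: "Q \<in> eps_free_CT" and R: "pconst (?\<sigma> ^ N) * P - Q \<in> ?J"
    using pseudo_division_CT[OF P] by blast
  let ?R = "pconst (?\<sigma> ^ N) * P - Q"
  have "f_ideal s n r d \<subseteq> (inertia_forms s n r d :: 'k C_poly set)"
  proof
    fix c :: "'k C_poly" assume c: "c \<in> f_ideal s n r d"
    then have "?\<sigma> ^ 0 * c \<in> f_ideal s n r d" by simp
    then show "c \<in> inertia_forms s n r d"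
      unfolding inertia_forms_iff_sigma_q using subsetD[OF f_idealD(1) c] by blast
  qed
  then have R0: "?R \<in> CT_set" "\<Phi> (G ?R) = 0"
    using FG_eq_0_if_inertia[of ?R] R polys_mono[OF _ subset_refl] by blast+
  have QCT: "Q \<in> CT_set" using Q by (rule subsetD[OF polys_mono[OF eps_free_subset subset_refl]])
  have "\<Phi> (G (pconst (?\<sigma> ^ N) * P)) = 0"
    using FG_mult[OF pconst_in_CT_set[OF sigma_q_power_in_C_set] P] assms(2) by simp
  moreover have "pconst (?\<sigma> ^ N) * P = Q + ?R" by simp
  ultimately have "\<Phi> (G Q) + \<Phi> (G ?R) = 0" using FG_add[OF QCT R0(1)] by simp
  then have "\<Phi> Q = 0" using R0(2) G_free[OF Q] by simp
  then have "Q = 0" by (rule eps_free_CT_kernel_trivial[OF Q])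
  with R have "pconst (?\<sigma> ^ N) * P \<in> ?J" by simp
  then have "?\<sigma> ^ N * Poly_Mapping.lookup P m \<in> f_ideal s n r d" for m
    using polys_lookup[of "pconst (?\<sigma> ^ N) * P" _ _ m] by (simp only: lookup_pconst_mult)
  then have "Poly_Mapping.lookup P m \<in> inertia_forms s n r d" for m
    unfolding inertia_forms_iff_sigma_q using polys_lookup[OF P] by blast
  then show ?thesis using P by (simp add: polys_def)
qed

end

end

end

theorem proposition3p3:
  fixes s r :: nat and n :: "nat \<Rightarrow> nat" and d :: "nat \<Rightarrow> nat \<Rightarrow> nat"
    and F :: "'k::idom CT_poly \<Rightarrow> ('k C_poly \<times> 'k C_poly) set"
    and G :: "'k CT_poly \<Rightarrow> 'k CT_poly"
  assumes "s \<ge> 1"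
    and "\<forall>j\<in>{1..s}. n j \<ge> 1"
    and "\<forall>j\<in>{1..s}. \<forall>k\<in>{1..s}. j \<le> k \<longrightarrow> n j \<le> n k"
    and "\<forall>i\<in>{1..r}. \<forall>j\<in>{1..s}. d i j \<ge> 1"
    and F_hom: "F \<in> ring_hom (CT_ring s n r d) (localization_at (C_ring s n r d) (sigma_q s n))"
    and F_C: "\<forall>c\<in>C_set s n r d. F (pconst c) = to_localization_at (C_ring s n r d) (sigma_q s n) c"
    and F_T: "\<forall>i\<in>{1..r}. F (pvar i) = f_over_tau s n r d i"
    and G_aut: "G \<in> ring_iso (CT_ring s n r d) (CT_ring s n r d)"
    and G_A': "\<forall>P\<in>A'XT_set s n r d. G P = P"
    and G_eps: "\<forall>i\<in>{1..r}. G (pconst (pconst (eps_poly s n d i)))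
      = pconst (pconst (eps_poly s n d i)) - pvar i"
  shows "a_kernel (CT_ring s n r d) (localization_at (C_ring s n r d) (sigma_q s n)) F
    = G ` polys (inertia_forms s n r d) {1..r}"
proof -
  let ?CT = "polys (C_set s n r d) {1..r} :: 'k CT_poly set" and ?C = "C_set s n r d :: 'k C_poly set"
  define M :: "'k C_poly set" where "M = range (\<lambda>k. sigma_q s n ^ k)"
  let ?L = "localization (ring_on ?C) M"
  have L: "localization_at (C_ring s n r d) (sigma_q s n) = ?L"
    by (simp add: localization_at_def C_ring_def powers_ring_on M_def)
  have toL: "to_localization_at (C_ring s n r d) (sigma_q s n) c = loc_frac (ring_on ?C) M c 1" for c
    by (simp add: to_localization_at_def C_ring_def powers_ring_on M_def)
  have S: "is_subring ?C" by (rule is_subring_C_set)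
  have "M \<subseteq> ?C" unfolding M_def using sigma_q_power_in_C_set by blast
  moreover have "0 \<notin> M" unfolding M_def using sigma_q_power_neq_0 by (metis imageE)
  moreover have one: "1 \<in> M" unfolding M_def by (metis power_0 rangeI)
  moreover have "x * y \<in> M" if xy: "x \<in> M" "y \<in> M" for x y
  proof -
    obtain k l where "x = sigma_q s n ^ k" "y = sigma_q s n ^ l" using xy unfolding M_def by blast
    then show ?thesis unfolding M_def by (metis power_add rangeI)
  qed
  ultimately have M: "M \<subseteq> ?C" "0 \<notin> M" "1 \<in> M" "\<And>x y. x \<in> M \<Longrightarrow> y \<in> M \<Longrightarrow> x * y \<in> M" by blast+
  note loc = S M
  have CT: "carrier (CT_ring s n r d) = ?CT" by (simp add: CT_ring_def)
  have F_in: "F x \<in> carrier ?L" if "x \<in> ?CT" for x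
    using ring_hom_closed[OF F_hom] that unfolding CT L by blast
  define \<Phi> where "\<Phi> x = frac_value (F x)" for x
  have \<Phi>_add: "\<Phi> (x + y) = \<Phi> x + \<Phi> y" if "x \<in> ?CT" "y \<in> ?CT" for x y
  proof -
    have "F (x + y) = F x \<oplus>\<^bsub>?L\<^esub> F y"
      using ring_hom_add[OF F_hom] that unfolding CT L by (simp add: CT_ring_def)
    then show ?thesis using frac_value_add[OF loc F_in[OF that(1)] F_in[OF that(2)]] by (simp add: \<Phi>_def)
  qed
  have \<Phi>_mult: "\<Phi> (x * y) = \<Phi> x * \<Phi> y" if "x \<in> ?CT" "y \<in> ?CT" for x y
  proof -
    have "F (x * y) = F x \<otimes>\<^bsub>?L\<^esub> F y"
      using ring_hom_mult[OF F_hom] that unfolding CT L by (simp add: CT_ring_def)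
    then show ?thesis using frac_value_mult(2)[OF loc F_in[OF that(1)] F_in[OF that(2)]] by (simp add: \<Phi>_def)
  qed
  have \<Phi>_const: "\<Phi> (pconst c) = to_fract c" if "c \<in> ?C" for c
    using frac_value_loc_frac[OF loc that one] F_C that by (simp add: \<Phi>_def toL)
  have \<Phi>_var: "\<Phi> (pvar i) = to_fract (f_poly s n d i) / to_fract (tau_poly s n d i)" if i: "i \<in> {1..r}" for i
  proof -
    let ?f = "f_poly s n d i :: 'k C_poly" and ?\<tau> = "tau_poly s n d i :: 'k C_poly"
    have f: "?f \<in> ?C" by (rule f_poly_in_C_set[OF i])
    have \<tau>: "?\<tau> \<in> ?C" by (rule subsetD[OF eps_free_subset tau_poly_in_eps_free])
    obtain N e where "e \<in> eps_free s r n d (\<lambda>j\<in>{1..s}. n j + 1)" and e: "e * ?\<tau> = sigma_q s n ^ N"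
      using tau_dvd_sigma_power[OF last_in_sigma_idx] unfolding sigma_q_eq tau_poly_eq by blast
    then have eC: "e \<in> ?C" using subsetD[OF eps_free_subset] by blast
    have \<sigma>: "e * ?\<tau> \<in> M" unfolding e M_def by blast
    have nz: "to_fract ?\<tau> \<noteq> 0" by (simp add: tau_poly_eq)
    \<comment> \<open>the inverse of \<open>\<tau>\<^sub>i / 1\<close> is \<open>e / \<sigma>\<^sub>q\<^sup>N\<close>, the denominator being written as \<open>e \<tau>\<^sub>i\<close>\<close>
    let ?x = "loc_frac (ring_on ?C) M ?\<tau> 1" and ?y = "loc_frac (ring_on ?C) M e (e * ?\<tau>)"
    have mem: "?x \<in> carrier ?L" "?y \<in> carrier ?L" "loc_frac (ring_on ?C) M ?f 1 \<in> carrier ?L"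
      using loc_frac_in_carrier[OF loc] \<tau> eC f one \<sigma> by blast+
    have "e * ?\<tau> \<noteq> 0" using M(2) \<sigma> by metis
    then have y: "frac_value ?y = 1 / to_fract ?\<tau>"
      by (simp add: frac_value_loc_frac[OF loc eC \<sigma>])
    have "frac_value ?x = to_fract ?\<tau>" using frac_value_loc_frac[OF loc \<tau> one] by simp
    then have "frac_value ?x * frac_value ?y = 1" unfolding y using nz by simp
    then have inv: "inv\<^bsub>?L\<^esub> ?x = ?y" by (intro frac_value_inv[OF loc mem(1,2)])
    have "F (pvar i) = loc_frac (ring_on ?C) M ?f 1 \<otimes>\<^bsub>?L\<^esub> ?y"
      using F_T i by (simp add: f_over_tau_def Let_def L toL inv)
    then show ?thesis
      using frac_value_mult(2)[OF loc mem(3) mem(2)] by (simp add: \<Phi>_def y frac_value_loc_frac[OF loc f one])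
  qed
  have zero_iff: "F x = \<zero>\<^bsub>?L\<^esub> \<longleftrightarrow> \<Phi> x = 0" if "x \<in> ?CT" for x
    using frac_value_inj[OF loc F_in[OF that] zero_in_localization[OF loc]] frac_value_zero[OF loc]
    unfolding \<Phi>_def by metis
  have G_hom: "G \<in> ring_hom (CT_ring s n r d) (CT_ring s n r d)" and G_bij: "bij_betw G ?CT ?CT"
    using G_aut by (simp_all add: ring_iso_def CT)
  have G_closed: "G x \<in> ?CT" if "x \<in> ?CT" for x
    using ring_hom_closed[OF G_hom] that by (simp add: CT)
  have G_add: "G (x + y) = G x + G y" if "x \<in> ?CT" "y \<in> ?CT" for x y
    using ring_hom_add[OF G_hom] that by (simp add: CT_ring_def)
  have G_mult: "G (x * y) = G x * G y" if "x \<in> ?CT" "y \<in> ?CT" for x y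
    using ring_hom_mult[OF G_hom] that by (simp add: CT_ring_def)
  have G_free: "G P = P" if "P \<in> polys (eps_free s r n d (\<lambda>j\<in>{1..s}. n j + 1)) {1..r}" for P
    using G_A' that unfolding A'XT_set_eq by blast
  have G_eps': "G (pconst (pconst (eps_poly s n d i))) = pconst (pconst (eps_poly s n d i)) - pvar i"
    if "i \<in> {1..r}" for i
    using G_eps that by blast
  note hyps = \<Phi>_add \<Phi>_mult \<Phi>_const \<Phi>_var G_closed G_add G_mult G_free G_eps'
  have kernel: "a_kernel (CT_ring s n r d) (localization_at (C_ring s n r d) (sigma_q s n)) F =
      {x \<in> ?CT. \<Phi> x = 0}"
    unfolding a_kernel_def' CT L using zero_iff by blast
  show ?thesis
    unfolding kernel
  proof (intro equalityI subsetI)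
    fix y assume "y \<in> {x \<in> ?CT. \<Phi> x = 0}"
    then have y: "y \<in> ?CT" "\<Phi> y = 0" by blast+
    then obtain P where P: "P \<in> ?CT" "y = G P" using G_bij by (auto simp: bij_betw_def)
    have "P \<in> polys (inertia_forms s n r d) {1..r}"
      by (rule inertia_if_FG_eq_0[where \<Phi> = \<Phi> and G = G]) (fact hyps P(1) y(2)[unfolded P(2)])+
    then show "y \<in> G ` polys (inertia_forms s n r d) {1..r}" unfolding P(2) by (rule imageI)
  next
    fix y assume "y \<in> G ` polys (inertia_forms s n r d) {1..r}"
    then obtain P where P: "P \<in> polys (inertia_forms s n r d) {1..r}" "y = G P" by blast
    have "P \<in> ?CT \<and> \<Phi> (G P) = 0"
      by (rule FG_eq_0_if_inertia[where \<Phi> = \<Phi> and G = G]) (fact hyps P(1))+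
    then show "y \<in> {x \<in> ?CT. \<Phi> x = 0}"
      unfolding P(2) using G_closed by blast
  qed
qed

end
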